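(* Let $(E,\mathcal{B})$ be a measurable space, $m$ a finite positive measure on it, and assume one of the following: (A$_1$) $(P_t)_{t\ge0}$ is a strongly continuous semigroup of Markovian operators on $L^p(m)$ for some $p\ge1$; or (A$_2$) $(P_t)_{t\ge0}$ is a measurable Markovian transition function on $(E,\mathcal{B})$ such that $m(f)=0$ implies $m(P_tf)=0$ for all $t>0$ and all positive $\mathcal{B}$-measurable $f$. Then the following assertions are equivalent: (i) There exists an invariant measure for $(P_t)_{t\ge0}$ which is absolutely continuous with respect to $m$. (ii) $m$ is almost invariant. (iii) $m$ is mean almost invariant with respect to every sequence $(t_n)_n$ of positive reals increasing to infinity. (iv) For every sequence $(t_n)_n$ of positive reals increasing to infinity, $c((P_t)_t,m,(t_n)_n)<m(E)$. (v) There exists a sequence $(t_n)_n$ of positive reals increasing to infinity such that $c((P_t)_t,m,(t_n)_n)<m(E)$.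
   Context: A Markovian operator on $L^p(m)$ is a linear operator preserving nonnegativity with $T1=1$. A Markovian transition function is a family of Markovian kernels $(P_t)_{t\ge 0}$ on $(E,\mathcal{B})$ with $P_tP_s=P_{t+s}$; it is measurable if $(t,x)\mapsto P_tf(x)$ is jointly measurable for every positive measurable $f$. An invariant measure for $(P_t)_{t\ge0}$ is a nonzero finite positive measure $\nu$ on $(E,\mathcal{B})$ with $\int P_tf\,d\nu=\int f\,d\nu$ for all $t>0$ and all bounded $\mathcal{B}$-measurable $f$. For a sequence $t_n\nearrow\infty$, $$c((P_t)_t,m,(t_n)_n):=\lim_{\varepsilon\searrow0}\ \sup_{A\in\mathcal{B},\,m(A)\le\varepsilon}\ \sup_n\ \frac1{t_n}\int_0^{t_n} m(P_s1_A)\,ds .$$ The measure $m$ is almost invariant if there exist $\delta\in[0,1)$ and a set function $\phi:\mathcal{B}\to\mathbb{R}_+$ with $\lim_{m(A)\to0}\phi(A)=0$ such that $m(P_t1_A)\le\delta m(E)+\phi(A)$ for all $t>0$ and $A\in\mathcal{B}$. It is mean almost invariant with respect to $(t_n)_n$ if there exist such $\delta,\phi$ with $\frac1{t_n}\int_0^{t_n} m(P_t1_A)\,dt\le\delta m(E)+\phi(A)$ for all $n$ and $A\in\mathcal{B}$. *)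

theory Defs
  imports "HOL-Probability.Probability"
begin

text \<open>Operators are represented pointwise: P t f is a representative of the image of f
  under the t-th operator.  m is the measure M; E = space M, B = sets M.\<close>

definition Lp_fun :: "real \<Rightarrow> 'a measure \<Rightarrow> ('a \<Rightarrow> real) \<Rightarrow> bool" where
  "Lp_fun p M f \<longleftrightarrow> f \<in> borel_measurable M \<and> integrable M (\<lambda>x. \<bar>f x\<bar> powr p)"

definition markov_Lp_semigroup ::
  "'a measure \<Rightarrow> real \<Rightarrow> (real \<Rightarrow> ('a \<Rightarrow> real) \<Rightarrow> 'a \<Rightarrow> real) \<Rightarrow> bool" where
  "markov_Lp_semigroup M p P \<longleftrightarrow> 1 \<le> p
   \<and> (\<forall>t\<ge>0. \<forall>f. Lp_fun p M f \<longrightarrow> Lp_fun p M (P t f))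
   \<and> (\<forall>t\<ge>0. \<forall>f g. Lp_fun p M f \<and> Lp_fun p M g \<and> (AE x in M. f x = g x)
        \<longrightarrow> (AE x in M. P t f x = P t g x))
   \<and> (\<forall>t\<ge>0. \<forall>f g a b. Lp_fun p M f \<and> Lp_fun p M g
        \<longrightarrow> (AE x in M. P t (\<lambda>y. a * f y + b * g y) x = a * P t f x + b * P t g x))
   \<and> (\<forall>t\<ge>0. \<forall>f. Lp_fun p M f \<and> (AE x in M. 0 \<le> f x) \<longrightarrow> (AE x in M. 0 \<le> P t f x))
   \<and> (\<forall>t\<ge>0. AE x in M. P t (\<lambda>_. 1) x = 1)
   \<and> (\<forall>f. Lp_fun p M f \<longrightarrow> (AE x in M. P 0 f x = f x))
   \<and> (\<forall>s\<ge>0. \<forall>t\<ge>0. \<forall>f. Lp_fun p M f \<longrightarrow> (AE x in M. P (t + s) f x = P t (P s f) x))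
   \<and> (\<forall>f. Lp_fun p M f \<longrightarrow>
        ((\<lambda>t. (\<integral>x. \<bar>P t f x - f x\<bar> powr p \<partial>M) powr (1 / p)) \<longlongrightarrow> 0) (at_right 0))"

definition markov_transition_function ::
  "'a measure \<Rightarrow> (real \<Rightarrow> 'a \<Rightarrow> 'a measure) \<Rightarrow> bool" where
  "markov_transition_function M K \<longleftrightarrow>
     (\<forall>t\<ge>0. K t \<in> M \<rightarrow>\<^sub>M prob_algebra M)
   \<and> (\<forall>s\<ge>0. \<forall>t\<ge>0. \<forall>x\<in>space M. \<forall>A\<in>sets M.
        emeasure (K (t + s) x) A = (\<integral>\<^sup>+ y. emeasure (K s y) A \<partial>K t x))
   \<and> (\<forall>f :: 'a \<Rightarrow> ennreal. f \<in> borel_measurable M \<longrightarrow>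
        (\<lambda>(t, x). \<integral>\<^sup>+ y. f y \<partial>K t x) \<in> borel_measurable (restrict_space borel {0..} \<Otimes>\<^sub>M M))
   \<and> (\<forall>f :: 'a \<Rightarrow> ennreal. f \<in> borel_measurable M \<and> (\<integral>\<^sup>+ x. f x \<partial>M) = 0 \<longrightarrow>
        (\<forall>t>0. (\<integral>\<^sup>+ x. (\<integral>\<^sup>+ y. f y \<partial>K t x) \<partial>M) = 0))"

definition kernel_op :: "(real \<Rightarrow> 'a \<Rightarrow> 'a measure) \<Rightarrow> real \<Rightarrow> ('a \<Rightarrow> real) \<Rightarrow> 'a \<Rightarrow> real" where
  "kernel_op K t f x = (\<integral>y. f y \<partial>K t x)"

definition mP :: "'a measure \<Rightarrow> (real \<Rightarrow> ('a \<Rightarrow> real) \<Rightarrow> 'a \<Rightarrow> real) \<Rightarrow> real \<Rightarrow> 'a set \<Rightarrow> real" where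
  "mP M P t A = (\<integral>x. P t (indicator A) x \<partial>M)"

definition avgP :: "'a measure \<Rightarrow> (real \<Rightarrow> ('a \<Rightarrow> real) \<Rightarrow> 'a \<Rightarrow> real) \<Rightarrow> real \<Rightarrow> 'a set \<Rightarrow> real" where
  "avgP M P T A = (1 / T) * set_lebesgue_integral lborel {0..T} (\<lambda>s. mP M P s A)"

definition cconst :: "'a measure \<Rightarrow> (real \<Rightarrow> ('a \<Rightarrow> real) \<Rightarrow> 'a \<Rightarrow> real) \<Rightarrow> (nat \<Rightarrow> real) \<Rightarrow> ereal" where
  "cconst M P tn = Lim (at_right (0::real))
     (\<lambda>\<epsilon>. SUP A \<in> {A \<in> sets M. measure M A \<le> \<epsilon>}. SUP n. ereal (avgP M P (tn n) A))"

definition incr_to_infinity :: "(nat \<Rightarrow> real) \<Rightarrow> bool" where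
  "incr_to_infinity tn \<longleftrightarrow> (\<forall>n. 0 < tn n) \<and> incseq tn \<and> filterlim tn at_top sequentially"

definition vanishing_setfun :: "'a measure \<Rightarrow> ('a set \<Rightarrow> real) \<Rightarrow> bool" where
  "vanishing_setfun M \<phi> \<longleftrightarrow> (\<forall>A\<in>sets M. 0 \<le> \<phi> A)
     \<and> (\<forall>e>0. \<exists>\<eta>>0. \<forall>A\<in>sets M. measure M A < \<eta> \<longrightarrow> \<phi> A < e)"

definition almost_invariant :: "'a measure \<Rightarrow> (real \<Rightarrow> ('a \<Rightarrow> real) \<Rightarrow> 'a \<Rightarrow> real) \<Rightarrow> bool" where
  "almost_invariant M P \<longleftrightarrow> (\<exists>\<delta> \<phi>. 0 \<le> \<delta> \<and> \<delta> < 1 \<and> vanishing_setfun M \<phi> \<and>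
     (\<forall>t>0. \<forall>A\<in>sets M. mP M P t A \<le> \<delta> * measure M (space M) + \<phi> A))"

definition mean_almost_invariant ::
  "'a measure \<Rightarrow> (real \<Rightarrow> ('a \<Rightarrow> real) \<Rightarrow> 'a \<Rightarrow> real) \<Rightarrow> (nat \<Rightarrow> real) \<Rightarrow> bool" where
  "mean_almost_invariant M P tn \<longleftrightarrow> (\<exists>\<delta> \<phi>. 0 \<le> \<delta> \<and> \<delta> < 1 \<and> vanishing_setfun M \<phi> \<and>
     (\<forall>n. \<forall>A\<in>sets M. avgP M P (tn n) A \<le> \<delta> * measure M (space M) + \<phi> A))"

definition invariant_measure ::
  "'a measure \<Rightarrow> (real \<Rightarrow> ('a \<Rightarrow> real) \<Rightarrow> 'a \<Rightarrow> real) \<Rightarrow> 'a measure \<Rightarrow> bool" where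
  "invariant_measure M P \<nu> \<longleftrightarrow> sets \<nu> = sets M \<and> finite_measure \<nu> \<and> emeasure \<nu> (space \<nu>) \<noteq> 0 \<and>
     (\<forall>t>0. \<forall>f \<in> borel_measurable M. bounded (f ` space M) \<longrightarrow>
        (\<integral>x. P t f x \<partial>\<nu>) = (\<integral>x. f x \<partial>\<nu>))"

end

(* For (v) ==> (i), let Lambda be a cluster point of the averages f |-> (1/t_n) int_0^{t_n} m(P_s f) ds,
   a positive functional on essentially bounded functions with Lambda (P_t f) = Lambda f. The outer
   measure nu generated by A |-> Lambda 1_A is the largest measure below Lambda (its countably additive
   part), and nu is not 0: if A_1, A_2, ... partition E, then m of the tail of the partition tends
   to 0, so Lambda of the tail is eventually at most some c < m(E) = Lambda 1. The measure
   A |-> nu (P_t 1_A) also lies below Lambda, hence below nu, and has the same mass, so nu is invariant.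
   For (i) ==> (ii), if nu has density rho, then m(P_t 1_A) <= m{rho <= 1/n} + n nu(A). Both hypotheses
   (A_1) and (A_2) reduce to an order continuous semigroup of operators on essentially bounded
   functions, indexed by t > 0 only, since a transition function need not be the identity at t = 0. *)
theory Submission
  imports Defs
begin

subsection \<open>Measure-theoretic preliminaries\<close>

text \<open>The obstacle is that \<Lambda> is only finitely additive: in the limit, mass may escape
  to sets of ever smaller measure, and the strict inequality c < m(E) is what keeps it from escaping
  entirely. For A |-> nu (P_t 1_A) to be comparable with nu it must be small on m-small sets. This
  is the order continuity recorded as \<open>P_small\<close>, carried over from m to nu by Markov's
  inequality. For kernels it comes from the null-set condition, because m K_t is a finite measure;
  on L^p it comes from positivity alone. Time averages also need s |-> m(P_s f) to be Borel: joint
  measurability gives this for kernels, and strong continuity at 0 gives right continuity on L^p.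
  The other implications are short. (ii) ==> (iii) averages a bound that is constant in time; (iii)
  ==> (iv) holds since on small sets \<phi> stays below half of (1 - \<delta>) m(E); (iv) ==> (v)
  needs only one admissible sequence.\<close>

lemma absolutely_continuous_epsilon_delta:
  assumes "finite_measure M" "finite_measure N" and ac: "absolutely_continuous M N"
    and sets: "sets N = sets M" and e: "0 < e"
  shows "\<exists>\<eta>>0. \<forall>A\<in>sets M. measure M A < \<eta> \<longrightarrow> measure N A < e"
proof (rule ccontr)
  interpret M: finite_measure M by fact
  interpret N: finite_measure N by fact
  assume *: "\<not> ?thesis"
  \<comment> \<open>Bad sets of measure below 2^-k are summable, so by Borel-Cantelli their limsup
    is null for \<open>M\<close> and hence for \<open>N\<close>. Continuity from above of the finite
    measure \<open>N\<close> still gives it measure at least \<open>e\<close>.\<close>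
  have "\<exists>A\<in>sets M. measure M A < (1/2)^k \<and> e \<le> measure N A" for k :: nat
  proof -
    have "0 < (1/2::real)^k" by simp
    with * show ?thesis by (meson not_less)
  qed
  then obtain A where A: "\<And>k. A k \<in> sets M" "\<And>k. measure M (A k) < (1/2)^k"
    "\<And>k. e \<le> measure N (A k)" by metis
  have "summable (\<lambda>k. measure M (A k))"
    using A(2) by (intro summable_comparison_test_ev[OF _ complete_algebra_summable_geometric[of "1/2"]])
      (auto simp: less_imp_le)
  then have "limsup A \<in> null_sets M"
    using A(1) by (intro borel_cantelli_limsup1) (auto simp: less_top[symmetric])
  then have "limsup A \<in> null_sets N" using ac by (auto simp: absolutely_continuous_def)
  moreover have "(\<lambda>n. measure N (\<Union>k\<in>{n..}. A k)) \<longlonglongrightarrow> measure N (\<Inter>n. \<Union>k\<in>{n..}. A k)"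
    using A(1) by (intro N.finite_Lim_measure_decseq) (auto simp: decseq_def sets dest: order_trans)
  moreover have "e \<le> measure N (\<Union>k\<in>{n..}. A k)" for n
    using A(1) sets by (intro order_trans[OF A(3)[of n]] N.finite_measure_mono) auto
  ultimately have "e \<le> measure N (limsup A)"
    by (auto simp: limsup_INF_SUP intro: LIMSEQ_le_const)
  with \<open>limsup A \<in> null_sets N\<close> e show False by (simp add: measure_eq_0_null_sets)
qed

text \<open>Rounding the argument to a grid on its right gives functions that factor through the
  integers, hence are measurable; right continuity makes them converge to \<open>f\<close>.\<close>

lemma right_continuous_borel_measurable:
  fixes f :: "real \<Rightarrow> real"
  assumes "\<And>x. (f \<longlongrightarrow> f x) (at_right x)"
  shows "f \<in> borel_measurable borel"
proof (rule borel_measurable_LIMSEQ_real)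
  \<comment> \<open>The first grid point strictly to the right of \<open>x\<close>, even when
    \<open>x\<close> is on the grid itself: \<open>at_right\<close> excludes
    \<open>x\<close>.\<close>
  define r where "r n x = (real_of_int \<lfloor>real (Suc n) * x\<rfloor> + 1) / real (Suc n)" for n :: nat and x :: real
  show "(\<lambda>x. f (r n x)) \<in> borel_measurable borel" for n
  proof -
    have "(\<lambda>i. f ((real_of_int i + 1) / real (Suc n))) \<in> borel_measurable (count_space UNIV)" by simp
    moreover have "(\<lambda>x. \<lfloor>real (Suc n) * x\<rfloor>) \<in> measurable borel (count_space UNIV)" by measurable
    ultimately show ?thesis unfolding r_def by (rule measurable_compose_rev)
  qed
  fix x :: real
  have gt: "x < r n x" for n
    unfolding r_def by (simp add: pos_less_divide_eq mult.commute del: of_nat_Suc)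
  have le: "r n x \<le> x + 1 / real (Suc n)" for n
  proof -
    have "real_of_int \<lfloor>real (Suc n) * x\<rfloor> + 1 \<le> (x + 1 / real (Suc n)) * real (Suc n)"
      by (simp add: algebra_simps del: of_nat_Suc)
    then show ?thesis unfolding r_def by (simp add: pos_divide_le_eq del: of_nat_Suc)
  qed
  have "(\<lambda>n. x + 1 / real (Suc n)) \<longlonglongrightarrow> x + 0"
    by (intro tendsto_intros LIMSEQ_Suc lim_1_over_n)
  moreover have "eventually (\<lambda>n. x \<le> r n x) sequentially"
    by (intro always_eventually allI less_imp_le gt)
  moreover have "eventually (\<lambda>n. r n x \<le> x + 1 / real (Suc n)) sequentially"
    by (intro always_eventually allI le)
  ultimately have "(\<lambda>n. r n x) \<longlonglongrightarrow> x"
    using tendsto_sandwich[OF _ _ tendsto_const[of x]] by simp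
  then have "filterlim (\<lambda>n. r n x) (at_right x) sequentially"
    by (intro filterlim_at_withinI) (auto simp: gt less_imp_neq[OF gt, symmetric])
  then show "(\<lambda>n. f (r n x)) \<longlonglongrightarrow> f x"
    using assms filterlim_compose by blast
qed

text \<open>Tychonoff's theorem replaces an ultrafilter (or a Banach limit) on \<open>nat\<close>.\<close>

lemma pointwise_bounded_cluster_filter:
  fixes \<phi> :: "nat \<Rightarrow> 'i \<Rightarrow> real"
  assumes bd: "\<And>n i. \<bar>\<phi> n i\<bar> \<le> B i"
  obtains \<Lambda> G where "G \<noteq> bot" "G \<le> sequentially" "\<And>i. ((\<lambda>n. \<phi> n i) \<longlongrightarrow> \<Lambda> i) G"
proof -
  let ?K = "PiE UNIV (\<lambda>i. {- B i..B i})"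
  have "compactin (product_topology (\<lambda>i. euclidean) UNIV) ?K"
    by (auto simp: compactin_PiE)
  then have "compact ?K" by (simp add: euclidean_product_topology)
  moreover have "eventually (\<lambda>f. f \<in> ?K) (filtermap \<phi> sequentially)"
    using bd by (simp add: eventually_filtermap abs_le_iff minus_le_iff PiE_UNIV_domain Pi_iff)
  ultimately obtain \<Lambda> where L: "inf (nhds \<Lambda>) (filtermap \<phi> sequentially) \<noteq> bot"
    unfolding compact_filter by (meson filtermap_bot_iff trivial_limit_sequentially)
  \<comment> \<open>A filter plays the role of a convergent subnet: it refines
    \<open>sequentially\<close>, \<phi> converges to \<Lambda> along it, and it is proper because
    \<Lambda> is a cluster point.\<close>
  define G where "G = inf sequentially (filtercomap \<phi> (nhds \<Lambda>))"
  have "G \<noteq> bot"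
  proof
    assume "G = bot"
    then have "eventually (\<lambda>_. False) G" by simp
    then obtain P Q where PQ: "eventually P sequentially" "eventually Q (filtercomap \<phi> (nhds \<Lambda>))"
      "\<And>n. P n \<Longrightarrow> Q n \<Longrightarrow> False"
      unfolding G_def eventually_inf by blast
    obtain R where R: "eventually R (nhds \<Lambda>)" "\<And>n. R (\<phi> n) \<Longrightarrow> Q n"
      using PQ(2) by (auto simp: eventually_filtercomap)
    have "eventually (\<lambda>f. \<not> R f) (filtermap \<phi> sequentially)"
      unfolding eventually_filtermap using PQ(1) by eventually_elim (use PQ(3) R(2) in blast)
    with R(1) have "eventually (\<lambda>_. False) (inf (nhds \<Lambda>) (filtermap \<phi> sequentially))"
      unfolding eventually_inf by blast
    with L show False by (simp add: trivial_limit_def)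
  qed
  moreover have "((\<lambda>n. \<phi> n i) \<longlongrightarrow> \<Lambda> i) G" for i
  proof -
    have "filterlim \<phi> (nhds \<Lambda>) G"
      unfolding filterlim_iff_le_filtercomap G_def by simp
    moreover have "((\<lambda>f. f i) \<longlongrightarrow> \<Lambda> i) (nhds \<Lambda>)"
      using continuous_on_product_coordinates[of i]
      by (auto simp: continuous_on_def tendsto_def eventually_nhds_conv_at)
    ultimately show ?thesis using filterlim_compose by blast
  qed
  ultimately show ?thesis using that[of G \<Lambda>] by (simp add: G_def)
qed

subsection \<open>Positive functionals on essentially bounded functions\<close>

text \<open>The bound holds only almost everywhere, since \<open>P t f\<close> is merely a
  representative: boundedness everywhere would not be preserved by the operators.\<close>

definition ess_bounded :: "'a measure \<Rightarrow> ('a \<Rightarrow> real) \<Rightarrow> bool" where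
  "ess_bounded M f \<longleftrightarrow> f \<in> borel_measurable M \<and> (\<exists>C. AE x in M. \<bar>f x\<bar> \<le> C)"

lemma ess_boundedI: "f \<in> borel_measurable M \<Longrightarrow> AE x in M. \<bar>f x\<bar> \<le> C \<Longrightarrow> ess_bounded M f"
  unfolding ess_bounded_def by blast

lemma ess_bounded_measurable[measurable_dest]: "ess_bounded M f \<Longrightarrow> f \<in> borel_measurable M"
  unfolding ess_bounded_def by blast

lemma ess_boundedE:
  assumes "ess_bounded M f" obtains C where "0 \<le> C" "AE x in M. \<bar>f x\<bar> \<le> C"
proof -
  obtain C where "AE x in M. \<bar>f x\<bar> \<le> C" using assms by (auto simp: ess_bounded_def)
  then have "AE x in M. \<bar>f x\<bar> \<le> max 0 C" by eventually_elim auto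
  then show ?thesis using that[of "max 0 C"] by simp
qed

lemma ess_bounded_const: "ess_bounded M (\<lambda>_. c)"
  by (rule ess_boundedI[of _ _ "\<bar>c\<bar>"]) auto

lemma ess_bounded_indicator: "A \<in> sets M \<Longrightarrow> ess_bounded M (indicator A)"
  by (rule ess_boundedI[of _ _ 1]) (auto simp: indicator_def)

lemma ess_bounded_lincomb:
  assumes "ess_bounded M f" "ess_bounded M g"
  shows "ess_bounded M (\<lambda>x. a * f x + b * g x)"
proof -
  note [measurable] = assms[THEN ess_bounded_measurable]
  obtain C where C: "0 \<le> C" "AE x in M. \<bar>f x\<bar> \<le> C" using assms(1) by (rule ess_boundedE)
  obtain D where D: "0 \<le> D" "AE x in M. \<bar>g x\<bar> \<le> D" using assms(2) by (rule ess_boundedE)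
  have "AE x in M. \<bar>a * f x + b * g x\<bar> \<le> \<bar>a\<bar> * C + \<bar>b\<bar> * D"
    using C(2) D(2)
  proof eventually_elim
    case (elim x)
    have "\<bar>a * f x + b * g x\<bar> \<le> \<bar>a\<bar> * \<bar>f x\<bar> + \<bar>b\<bar> * \<bar>g x\<bar>"
      by (metis abs_mult abs_triangle_ineq)
    also have "\<dots> \<le> \<bar>a\<bar> * C + \<bar>b\<bar> * D" using elim by (intro add_mono mult_left_mono) auto
    finally show ?case .
  qed
  then show ?thesis by (intro ess_boundedI) auto
qed

lemma ess_bounded_add: "ess_bounded M f \<Longrightarrow> ess_bounded M g \<Longrightarrow> ess_bounded M (\<lambda>x. f x + g x)"
  using ess_bounded_lincomb[of M f g 1 1] by simp

lemma ess_bounded_diff: "ess_bounded M f \<Longrightarrow> ess_bounded M g \<Longrightarrow> ess_bounded M (\<lambda>x. f x - g x)"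
  using ess_bounded_lincomb[of M f g 1 "-1"] by simp

lemma ess_bounded_cmult: "ess_bounded M f \<Longrightarrow> ess_bounded M (\<lambda>x. a * f x)"
  using ess_bounded_lincomb[of M f f a 0] by simp

lemma ess_bounded_sum:
  "finite J \<Longrightarrow> (\<And>j. j \<in> J \<Longrightarrow> ess_bounded M (f j)) \<Longrightarrow> ess_bounded M (\<lambda>x. \<Sum>j\<in>J. f j x)"
  by (induction J rule: finite_induct) (auto intro: ess_bounded_const ess_bounded_add)

lemma (in finite_measure) ess_bounded_integrable: "ess_bounded M f \<Longrightarrow> integrable M f"
  unfolding ess_bounded_def real_norm_def[symmetric] by (blast intro: integrable_const_bound)

text \<open>A positive element of the dual of L^\<infinity>, written on functions instead of
  classes. Positivity already forces equal values on functions that agree almost everywhere, see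
  \<open>pos_functional_cong\<close>.\<close>

definition pos_functional :: "'a measure \<Rightarrow> (('a \<Rightarrow> real) \<Rightarrow> real) \<Rightarrow> bool" where
  "pos_functional M L \<longleftrightarrow>
     (\<forall>f g a b. ess_bounded M f \<longrightarrow> ess_bounded M g \<longrightarrow> L (\<lambda>x. a * f x + b * g x) = a * L f + b * L g) \<and>
     (\<forall>f. ess_bounded M f \<longrightarrow> (AE x in M. 0 \<le> f x) \<longrightarrow> 0 \<le> L f)"

context
  fixes M :: "'a measure" and L
  assumes L: "pos_functional M L"
begin

lemma pos_functional_lincomb:
  "ess_bounded M f \<Longrightarrow> ess_bounded M g \<Longrightarrow> L (\<lambda>x. a * f x + b * g x) = a * L f + b * L g"
  using L by (auto simp: pos_functional_def)

lemma pos_functional_nonneg: "ess_bounded M f \<Longrightarrow> AE x in M. 0 \<le> f x \<Longrightarrow> 0 \<le> L f"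
  using L by (auto simp: pos_functional_def)

lemma pos_functional_add:
  "ess_bounded M f \<Longrightarrow> ess_bounded M g \<Longrightarrow> L (\<lambda>x. f x + g x) = L f + L g"
  using pos_functional_lincomb[of f g 1 1] by simp

lemma pos_functional_diff:
  "ess_bounded M f \<Longrightarrow> ess_bounded M g \<Longrightarrow> L (\<lambda>x. f x - g x) = L f - L g"
  using pos_functional_lincomb[of f g 1 "-1"] by simp

lemma pos_functional_cmult: "ess_bounded M f \<Longrightarrow> L (\<lambda>x. a * f x) = a * L f"
  using pos_functional_lincomb[of f f a 0] by simp

lemma pos_functional_const: "L (\<lambda>_. c) = c * L (\<lambda>_. 1)"
  using pos_functional_cmult[OF ess_bounded_const[of M 1], of c] by simp

lemma pos_functional_sum:
  "finite J \<Longrightarrow> (\<And>j. j \<in> J \<Longrightarrow> ess_bounded M (f j)) \<Longrightarrow> L (\<lambda>x. \<Sum>j\<in>J. f j x) = (\<Sum>j\<in>J. L (f j))"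
proof (induction J rule: finite_induct)
  case empty
  then show ?case using pos_functional_const[of 0] by simp
next
  case (insert j J)
  then show ?case using pos_functional_add[of "f j" "\<lambda>x. \<Sum>j\<in>J. f j x"] ess_bounded_sum[of J M f] by simp
qed

lemma pos_functional_mono:
  assumes "ess_bounded M f" "ess_bounded M g" "AE x in M. f x \<le> g x"
  shows "L f \<le> L g"
  using pos_functional_nonneg[OF ess_bounded_diff[OF assms(2,1)]] assms pos_functional_diff by auto

lemma pos_functional_cong:
  assumes "ess_bounded M f" "ess_bounded M g" "AE x in M. f x = g x"
  shows "L f = L g"
  using assms by (intro antisym pos_functional_mono) auto

lemma pos_functional_bound:
  assumes "ess_bounded M f" "AE x in M. \<bar>f x\<bar> \<le> C"
  shows "\<bar>L f\<bar> \<le> C * L (\<lambda>_. 1)"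
proof -
  have "L f \<le> L (\<lambda>_. C)" "L (\<lambda>_. - C) \<le> L f"
    using assms(2) by (intro pos_functional_mono ess_bounded_const assms(1); force)+
  then show ?thesis using pos_functional_const[of C] pos_functional_const[of "-C"] by auto
qed

lemma pos_functional_one_nonneg: "0 \<le> L (\<lambda>_. 1)"
  by (rule pos_functional_nonneg[OF ess_bounded_const]) auto

lemma pos_functional_indicator_mono:
  "A \<in> sets M \<Longrightarrow> B \<in> sets M \<Longrightarrow> A \<subseteq> B \<Longrightarrow> L (indicator A) \<le> L (indicator B)"
  by (intro pos_functional_mono ess_bounded_indicator) (auto simp: indicator_def)

lemma pos_functional_indicator_Un:
  assumes "A \<in> sets M" "B \<in> sets M" "A \<inter> B = {}"
  shows "L (indicator (A \<union> B)) = L (indicator A) + L (indicator B)"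
proof -
  have "indicator (A \<union> B) = (\<lambda>x. indicator A x + indicator B x :: real)"
    using assms(3) by (auto simp: indicator_def fun_eq_iff)
  then show ?thesis using assms by (simp add: pos_functional_add ess_bounded_indicator)
qed

lemma pos_functional_indicator_space: "L (indicator (space M)) = L (\<lambda>_. 1)"
  by (intro pos_functional_cong ess_bounded_indicator ess_bounded_const) auto

lemma pos_functional_indicator_nonneg: "A \<in> sets M \<Longrightarrow> 0 \<le> L (indicator A)"
  by (intro pos_functional_nonneg ess_bounded_indicator) auto

end

text \<open>Comparison on indicators passes to step functions by linearity. A step function
  \<open>s\<close> of mesh 1/k has s \<le> f \<le> s + 1/k, and the error is at most L1 1 / k. No
  continuity of the functionals enters.\<close>

lemma pos_functional_le:
  assumes L1: "pos_functional M L1" and L2: "pos_functional M L2"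
    and le: "\<And>A. A \<in> sets M \<Longrightarrow> L1 (indicator A) \<le> L2 (indicator A)"
    and f: "ess_bounded M f" "AE x in M. 0 \<le> f x"
  shows "L1 f \<le> L2 f"
proof -
  obtain C where C: "0 \<le> C" "AE x in M. \<bar>f x\<bar> \<le> C" using f(1) by (rule ess_boundedE)
  note [measurable] = ess_bounded_measurable[OF f(1)]
  have approx: "L1 f \<le> L2 f + 1 / real k * L1 (\<lambda>_. 1)" if k: "0 < k" for k :: nat
  proof -
    define A where "A j = {x \<in> space M. real j / k \<le> f x \<and> f x < (real j + 1) / k}" for j :: nat
    have A: "A j \<in> sets M" for j unfolding A_def by measurable
    \<comment> \<open>Almost everywhere \<open>f\<close> is at most \<open>C\<close>, so the levels
      up to \<open>N\<close> catch every value and the step function is a finite sum.\<close>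
    define N where "N = nat \<lceil>C * k\<rceil>"
    define s where "s x = (\<Sum>j\<le>N. real j / k * indicator (A j) x)" for x
    have ebA: "ess_bounded M (\<lambda>x. real j / k * indicator (A j) x)" for j
      by (intro ess_bounded_cmult ess_bounded_indicator A)
    have s: "ess_bounded M s" unfolding s_def by (intro ess_bounded_sum ebA) auto
    have Ls: "L s = (\<Sum>j\<le>N. real j / k * L (indicator (A j)))" if "pos_functional M L" for L
      unfolding s_def
      using pos_functional_sum[OF that, of "{..N}" "\<lambda>j x. real j / k * indicator (A j) x", OF _ ebA]
      unfolding pos_functional_cmult[OF that ess_bounded_indicator[OF A]] by blast
    have bounds: "AE x in M. s x \<le> f x \<and> f x \<le> s x + 1 / k"
      using C(2) f(2) AE_space
    proof eventually_elim
      case (elim x)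
      define j0 where "j0 = nat \<lfloor>f x * k\<rfloor>"
      have j0: "real j0 \<le> f x * k" "f x * k < real j0 + 1"
        using elim k by (auto simp: j0_def)
      have "f x * k \<le> C * k" using elim k by (intro mult_right_mono) auto
      then have "j0 \<le> N" unfolding j0_def N_def by linarith
      have eq: "indicator (A j) x = (if j = j0 then 1 else 0 :: real)" for j
      proof -
        have "x \<in> A j \<longleftrightarrow> real j \<le> f x * k \<and> f x * k < real j + 1"
          using k elim by (auto simp: A_def field_simps)
        also have "\<dots> \<longleftrightarrow> j = j0" using j0 by auto
        finally show ?thesis by (auto simp: indicator_def)
      qed
      have "s x = real j0 / k"
        unfolding s_def eq using \<open>j0 \<le> N\<close> by (simp add: if_distrib cong: if_cong)
      then show ?case using j0 k
        by (simp add: pos_divide_le_eq pos_le_divide_eq add_divide_distrib[symmetric])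
    qed
    have "L1 f \<le> L1 (\<lambda>x. s x + 1 / k)"
      using bounds by (intro pos_functional_mono[OF L1] f ess_bounded_add s ess_bounded_const) auto
    also have "\<dots> = L1 s + 1 / k * L1 (\<lambda>_. 1)"
      using pos_functional_add[OF L1 s ess_bounded_const] pos_functional_const[OF L1, of "1/k"] by simp
    also have "L1 s \<le> L2 s"
      unfolding Ls[OF L1] Ls[OF L2] by (intro sum_mono mult_left_mono le A) auto
    also have "L2 s \<le> L2 f" using bounds by (intro pos_functional_mono[OF L2] f s) auto
    finally show ?thesis by simp
  qed
  have "(\<lambda>k. L2 f + 1 / real k * L1 (\<lambda>_. 1)) \<longlonglongrightarrow> L2 f + 0 * L1 (\<lambda>_. 1)"
    by (intro tendsto_intros lim_1_over_n)
  then have "L1 f \<le> L2 f + 0 * L1 (\<lambda>_. 1)"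
    by (rule LIMSEQ_le_const) (use approx in \<open>auto intro!: exI[of _ 1]\<close>)
  then show ?thesis by simp
qed

text \<open>Here \<open>N\<close> is the reference measure and \<open>M\<close> the one integrated
  against; absolute continuity moves bounds and signs from \<open>N\<close>-almost everywhere to
  \<open>M\<close>-almost everywhere.\<close>

lemma (in finite_measure) pos_functional_integral:
  assumes "absolutely_continuous N M" "sets M = sets N"
  shows "pos_functional N (\<lambda>f. \<integral>x. f x \<partial>M)"
proof -
  have int: "integrable M f" if f: "ess_bounded N f" for f
  proof -
    obtain C where C: "AE x in N. \<bar>f x\<bar> \<le> C" using f by (rule ess_boundedE)
    have "AE x in M. \<bar>f x\<bar> \<le> C" by (rule absolutely_continuous_AE[OF assms(2,1) C])
    then show ?thesis using ess_bounded_measurable[OF f] assms(2)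
      by (intro integrable_const_bound[of _ C]) (auto cong: measurable_cong_sets)
  qed
  show ?thesis unfolding pos_functional_def
    by (auto simp: int intro: integral_nonneg_AE absolutely_continuous_AE[OF assms(2,1)])
qed

lemma pos_functional_indicator_Un_le:
  assumes L: "pos_functional M L" and "A \<in> sets M" "B \<in> sets M"
  shows "L (indicator (A \<union> B)) \<le> L (indicator A) + L (indicator B)"
proof -
  have "L (indicator (A \<union> B)) \<le> L (\<lambda>x. indicator A x + indicator B x)"
    using assms by (intro pos_functional_mono[OF L] ess_bounded_add ess_bounded_indicator) (auto simp: indicator_def)
  then show ?thesis using assms by (simp add: pos_functional_add[OF L] ess_bounded_indicator)
qed

lemma pos_functional_indicator_empty:
  assumes "pos_functional M L" shows "L (indicator {}) = 0"
proof -
  have "L (indicator {}) = L (\<lambda>_. 0)" by (rule arg_cong[of _ _ L]) (simp add: fun_eq_iff)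
  then show ?thesis using pos_functional_const[OF assms, of 0] by (simp only: mult_zero_left)
qed

lemma pos_functional_indicator_UN_le:
  fixes N :: nat
  assumes L: "pos_functional M L" and A: "\<And>i. A i \<in> sets M"
  shows "L (indicator (\<Union>i<N. A i)) \<le> (\<Sum>i<N. L (indicator (A i)))"
proof (induction N)
  case 0
  then show ?case using pos_functional_indicator_empty[OF L] by (simp only: lessThan_0 UN_empty sum.empty)
next
  case (Suc N)
  have "(\<Union>i<Suc N. A i) = (\<Union>i<N. A i) \<union> A N" by (auto simp: less_Suc_eq)
  then show ?case
    using pos_functional_indicator_Un_le[OF L, of "\<Union>i<N. A i" "A N"] A Suc by auto
qed

section \<open>The countably additive part of a positive functional\<close>

definition functional_outer :: "'a measure \<Rightarrow> (('a \<Rightarrow> real) \<Rightarrow> real) \<Rightarrow> 'a set \<Rightarrow> ennreal" where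
  "functional_outer M L = outer_measure (sets M) (\<lambda>A. ennreal (L (indicator A)))"

text \<open>Finite additivity of A |-> L 1_A is enough for every set in \<open>sets M\<close> to be
  Caratheodory measurable. The price is that the resulting measure may be strictly smaller than
  \<open>L\<close> on sets.\<close>

lemma functional_outer_measure_space:
  assumes L: "pos_functional M L"
  shows "measure_space (space M) (sets M) (functional_outer M L)"
proof -
  let ?F = "\<lambda>A. ennreal (L (indicator A))"
  have pos: "positive (sets M) ?F"
    using pos_functional_indicator_empty[OF L] by (simp only: positive_def ennreal_0)
  have inc: "increasing (sets M) ?F"
    by (auto simp: increasing_def intro: ennreal_leI pos_functional_indicator_mono[OF L])
  have add: "additive (sets M) ?F"
    by (auto simp: additive_def pos_functional_indicator_Un[OF L] pos_functional_indicator_nonneg[OF L])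
  have "measure_space (space M) (lambda_system (space M) (Pow (space M)) (functional_outer M L)) (functional_outer M L)"
    unfolding functional_outer_def
    using sigma_algebra.caratheodory_lemma[OF sigma_algebra_Pow
        sets.outer_measure_space_outer_measure[OF pos inc]] by simp
  from measure_down[OF this sets.sigma_algebra_axioms] show ?thesis
    using sets.algebra_subset_lambda_system[OF pos inc add] unfolding functional_outer_def by blast
qed

lemma functional_outer_le:
  assumes L: "pos_functional M L" and A: "A \<in> sets M"
  shows "functional_outer M L A \<le> ennreal (L (indicator A))"
proof -
  have "functional_outer M L A \<le> (\<Sum>i. ennreal (L (indicator (if i = 0 then A else {}))))"
    unfolding functional_outer_def outer_measure_def using A
    by (intro INF_lower2[of "\<lambda>i. if i = 0 then A else {}"]) (auto simp: disjoint_family_on_def)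
  also have "\<dots> = ennreal (L (indicator A))"
    using pos_functional_indicator_empty[OF L] by (subst suminf_finite[of "{0}"]) auto
  finally show ?thesis .
qed

text \<open>With \<open>e\<close> arbitrarily small this says that \<open>functional_outer M L'\<close> dominates every measure below
  \<open>L'\<close>; with \<open>L = L'\<close> and \<open>e < L (\<lambda>_. 1)\<close> it says that the measure is nonzero.\<close>

lemma functional_outer_lower:
  assumes "finite_measure M" and L: "pos_functional M L" and L': "pos_functional M L'"
    and le: "\<And>A. A \<in> sets M \<Longrightarrow> L (indicator A) \<le> L' (indicator A)"
    and small: "0 \<le> e" "0 < \<eta>" "\<And>B. B \<in> sets M \<Longrightarrow> measure M B < \<eta> \<Longrightarrow> L (indicator B) \<le> e"
    and A: "A \<in> sets M"
  shows "ennreal (L (indicator A)) \<le> functional_outer M L' A + ennreal e"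
proof -
  interpret finite_measure M by fact
  have "ennreal (L (indicator A) - e) \<le> functional_outer M L' A"
    unfolding functional_outer_def outer_measure_def
  proof (safe intro!: INF_greatest)
    fix B :: "nat \<Rightarrow> 'a set"
    assume "range B \<subseteq> sets M" "disjoint_family B" and AB: "A \<subseteq> (\<Union>i. B i)"
    then have B: "B i \<in> sets M" for i by auto
    \<comment> \<open>The part of \<open>A\<close> missed by the first \<open>N\<close> covering
      sets. It decreases to the empty set, so countable additivity of \<open>M\<close> makes it
      small enough for the hypothesis on \<open>L\<close>; on the finite union, finite subadditivity
      suffices.\<close>
    define R where "R N = A - (\<Union>i<N. B i)" for N :: nat
    have R: "R N \<in> sets M" for N using A B by (auto simp: R_def)
    have "(\<lambda>N. measure M (R N)) \<longlonglongrightarrow> measure M (\<Inter>N. R N)"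
      using R by (intro finite_Lim_measure_decseq) (auto simp: decseq_def R_def)
    moreover have "(\<Inter>N. R N) = {}" using AB by (auto simp: R_def)
    ultimately have "eventually (\<lambda>N. measure M (R N) < \<eta>) sequentially"
      using small(2) by (intro order_tendstoD(2)[of _ 0]) auto
    then obtain N where N: "measure M (R N) < \<eta>" by (auto simp: eventually_sequentially)
    have "(\<Sum>i<N. L (indicator (B i))) \<le> (\<Sum>i<N. L' (indicator (B i)))"
      by (intro sum_mono le B)
    with pos_functional_indicator_UN_le[OF L, of B N, OF B] small(3)[OF R N]
    have le_sum: "L (indicator (\<Union>i<N. B i)) + L (indicator (R N)) \<le> (\<Sum>i<N. L' (indicator (B i))) + e"
      by (meson add_mono order_trans)
    have "L (indicator A) \<le> L (indicator ((\<Union>i<N. B i) \<union> R N))"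
      using A B R by (intro pos_functional_indicator_mono[OF L]) (auto simp: R_def)
    also have "\<dots> \<le> L (indicator (\<Union>i<N. B i)) + L (indicator (R N))"
      using B R by (intro pos_functional_indicator_Un_le[OF L]) auto
    also have "\<dots> \<le> (\<Sum>i<N. L' (indicator (B i))) + e"
      by (rule le_sum)
    finally have "ennreal (L (indicator A) - e) \<le> ennreal (\<Sum>i<N. L' (indicator (B i)))"
      by (intro ennreal_leI) simp
    also have "\<dots> = (\<Sum>i<N. ennreal (L' (indicator (B i))))"
      using pos_functional_indicator_nonneg[OF L' B] by (simp add: sum_ennreal)
    also have "\<dots> \<le> (\<Sum>i. ennreal (L' (indicator (B i))))"
      by (intro sum_le_suminf) auto
    finally show "ennreal (L (indicator A) - e) \<le> (\<Sum>i. ennreal (L' (indicator (B i))))" .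
  qed
  then have "ennreal (L (indicator A) - e) + ennreal e \<le> functional_outer M L' A + ennreal e"
    by (rule add_right_mono)
  \<comment> \<open>\<open>ennreal\<close> truncates negative reals to 0, hence the two
    cases.\<close>
  moreover have "ennreal (L (indicator A)) \<le> ennreal (L (indicator A) - e) + ennreal e"
  proof (cases "e \<le> L (indicator A)")
    case True
    then show ?thesis using small(1) by (simp flip: ennreal_plus)
  next
    case False
    then show ?thesis by (intro add_increasing ennreal_leI) auto
  qed
  ultimately show ?thesis by (rule order_trans[rotated])
qed

subsection \<open>Markov semigroups on essentially bounded functions\<close>

text \<open>The common ground of both hypotheses. \<open>P_small\<close> is order continuity in
  epsilon-delta form, and \<open>P_time_measurable\<close> is what the time averages require. The
  factor \<open>indicator {0<..} s\<close> cuts off the times about which nothing is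
  assumed.\<close>

locale ess_markov_semigroup = finite_measure M for M :: "'a measure" +
  fixes P :: "real \<Rightarrow> ('a \<Rightarrow> real) \<Rightarrow> 'a \<Rightarrow> real"
  assumes P_measurable: "0 < t \<Longrightarrow> ess_bounded M f \<Longrightarrow> P t f \<in> borel_measurable M"
    and P_lincomb: "0 < t \<Longrightarrow> ess_bounded M f \<Longrightarrow> ess_bounded M g \<Longrightarrow>
      AE x in M. P t (\<lambda>y. a * f y + b * g y) x = a * P t f x + b * P t g x"
    and P_nonneg: "0 < t \<Longrightarrow> ess_bounded M f \<Longrightarrow> AE x in M. 0 \<le> f x \<Longrightarrow> AE x in M. 0 \<le> P t f x"
    and P_one: "0 < t \<Longrightarrow> AE x in M. P t (\<lambda>_. 1) x = 1"
    and P_semigroup: "0 < s \<Longrightarrow> 0 < t \<Longrightarrow> ess_bounded M f \<Longrightarrow> AE x in M. P (t + s) f x = P t (P s f) x"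
    and P_small: "0 < t \<Longrightarrow> 0 < e \<Longrightarrow>
      \<exists>\<eta>>0. \<forall>A\<in>sets M. measure M A < \<eta> \<longrightarrow> (\<integral>x. P t (indicator A) x \<partial>M) < e"
    and P_time_measurable: "ess_bounded M f \<Longrightarrow>
      (\<lambda>s. indicator {0<..} s * (\<integral>x. P s f x \<partial>M)) \<in> borel_measurable borel"
begin

lemma P_const: "0 < t \<Longrightarrow> AE x in M. P t (\<lambda>_. c) x = c"
  using P_lincomb[of t "\<lambda>_. 1" "\<lambda>_. 1" c 0] P_one[of t] ess_bounded_const[of M 1] by auto

lemma P_mono:
  assumes "0 < t" "ess_bounded M f" "ess_bounded M g" "AE x in M. f x \<le> g x"
  shows "AE x in M. P t f x \<le> P t g x"
proof -
  have "AE x in M. 0 \<le> P t (\<lambda>x. 1 * g x + (-1) * f x) x"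
    using assms by (intro P_nonneg ess_bounded_lincomb) auto
  with P_lincomb[OF assms(1,3,2), of 1 "-1"] show ?thesis by auto
qed

lemma P_bound:
  assumes "0 < t" "ess_bounded M f" "AE x in M. \<bar>f x\<bar> \<le> C"
  shows "AE x in M. \<bar>P t f x\<bar> \<le> C"
proof -
  have "AE x in M. P t f x \<le> P t (\<lambda>_. C) x"
    by (rule P_mono[OF assms(1,2) ess_bounded_const]) (use assms(3) in auto)
  moreover have "AE x in M. P t (\<lambda>_. - C) x \<le> P t f x"
    by (rule P_mono[OF assms(1) ess_bounded_const assms(2)]) (use assms(3) in auto)
  ultimately show ?thesis using P_const[OF assms(1), of C] P_const[OF assms(1), of "- C"]
    by auto
qed

lemma P_ess_bounded: "0 < t \<Longrightarrow> ess_bounded M f \<Longrightarrow> ess_bounded M (P t f)"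
  by (meson P_bound P_measurable ess_boundedE ess_boundedI)

lemma P_indicator:
  assumes "0 < t" "A \<in> sets M"
  shows "AE x in M. 0 \<le> P t (indicator A) x \<and> P t (indicator A) x \<le> 1"
  using P_nonneg[OF assms(1) ess_bounded_indicator[OF assms(2)]]
    P_bound[OF assms(1) ess_bounded_indicator[OF assms(2)], of 1] by auto

lemma pos_functional_comp:
  assumes L: "pos_functional M L" and t: "0 < t"
  shows "pos_functional M (\<lambda>f. L (P t f))"
  unfolding pos_functional_def
proof (intro conjI allI impI)
  fix f g a b assume fg: "ess_bounded M f" "ess_bounded M g"
  have "L (P t (\<lambda>y. a * f y + b * g y)) = L (\<lambda>x. a * P t f x + b * P t g x)"
    using fg t by (intro pos_functional_cong[OF L] P_ess_bounded ess_bounded_lincomb P_lincomb)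
  then show "L (P t (\<lambda>y. a * f y + b * g y)) = a * L (P t f) + b * L (P t g)"
    using fg t by (simp add: pos_functional_lincomb[OF L] P_ess_bounded)
qed (use t P_nonneg P_ess_bounded pos_functional_nonneg[OF L] in blast)

lemma pos_functional_mean: "pos_functional M (\<lambda>f. \<integral>x. f x \<partial>M)"
  by (rule pos_functional_integral) (auto simp: absolutely_continuous_def)

lemma pos_functional_P: "0 < t \<Longrightarrow> pos_functional M (\<lambda>f. \<integral>x. P t f x \<partial>M)"
  by (rule pos_functional_comp[OF pos_functional_mean])

lemma integral_P_one: "0 < t \<Longrightarrow> (\<integral>x. P t (\<lambda>_. 1) x \<partial>M) = measure M (space M)"
  using integral_cong_AE[OF P_measurable[OF _ ess_bounded_const] _ P_one, of t] by simp

section \<open>Orbits in time and their averages\<close>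

definition orbit :: "('a \<Rightarrow> real) \<Rightarrow> real \<Rightarrow> real" where
  "orbit f s = indicator {0<..} s * (\<integral>x. P s f x \<partial>M)"

lemma orbit_measurable: "ess_bounded M f \<Longrightarrow> orbit f \<in> borel_measurable borel"
  unfolding orbit_def[abs_def] by (rule P_time_measurable)

lemma orbit_bound:
  assumes "ess_bounded M f" "AE x in M. \<bar>f x\<bar> \<le> C" "0 \<le> C"
  shows "\<bar>orbit f s\<bar> \<le> C * measure M (space M)"
  using assms pos_functional_bound[OF pos_functional_P assms(1,2), of s]
  by (auto simp: orbit_def indicator_def integral_P_one)

lemma orbit_integrable:
  assumes "ess_bounded M f" "A \<in> sets borel" "emeasure lborel A < \<infinity>"
  shows "integrable lborel (\<lambda>s. indicator A s * orbit f s)"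
proof -
  obtain C where C: "0 \<le> C" "AE x in M. \<bar>f x\<bar> \<le> C" using assms(1) by (rule ess_boundedE)
  note [measurable] = orbit_measurable[OF assms(1)] assms(2)
  show ?thesis
    using orbit_bound[OF assms(1) C(2,1)] C(1)
    by (intro integrableI_bounded_set[of A _ _ "C * measure M (space M)"] assms)
      (auto simp: indicator_def assms)
qed

definition avg :: "real \<Rightarrow> ('a \<Rightarrow> real) \<Rightarrow> real" where
  "avg T f = 1 / T * (\<integral>s. indicator {0..T} s * orbit f s \<partial>lborel)"

text \<open>The two integrands differ at most at time 0, where \<open>mP\<close> is arbitrary and
  \<open>orbit\<close> is 0; a single point is Lebesgue null.\<close>

lemma avgP_eq:
  assumes "A \<in> sets M"
  shows "avgP M P T A = avg T (indicator A)"
proof -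
  have "AE s in lborel. indicator {0..T} s * mP M P s A = indicator {0..T} s * orbit (indicator A) s"
    using AE_lborel_singleton[of 0]
    by eventually_elim (auto simp: orbit_def mP_def indicator_def)
  moreover have "(\<lambda>s. indicator {0..T} s * orbit (indicator A) s) \<in> borel_measurable lborel"
    using orbit_measurable[OF ess_bounded_indicator[OF assms]] by simp
  \<comment> \<open>Agreement almost everywhere does not transfer Borel measurability, so the
    integrand is rebuilt from \<open>orbit\<close> with its value at 0 patched in.\<close>
  moreover have "(\<lambda>s. indicator {0..T} s * mP M P s A) \<in> borel_measurable lborel"
  proof -
    have "(\<lambda>s. if s = 0 then indicator {0..T} 0 * mP M P 0 A else indicator {0..T} s * orbit (indicator A) s)
      \<in> borel_measurable lborel"
      using orbit_measurable[OF ess_bounded_indicator[OF assms]] by measurable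
    also have "(\<lambda>s. if s = 0 then indicator {0..T} 0 * mP M P 0 A else indicator {0..T} s * orbit (indicator A) s)
      = (\<lambda>s. indicator {0..T} s * mP M P s A)"
      by (auto simp: fun_eq_iff orbit_def mP_def indicator_def)
    finally show ?thesis .
  qed
  ultimately show ?thesis
    unfolding avgP_def avg_def set_lebesgue_integral_def real_scaleR_def
    by (intro arg_cong2[where f = "(*)"] refl integral_cong_AE) auto
qed

lemma pos_functional_avg:
  assumes "0 < T"
  shows "pos_functional M (avg T)"
  unfolding pos_functional_def
proof (intro conjI allI impI)
  fix f g a b assume fg: "ess_bounded M f" "ess_bounded M g"
  have "orbit (\<lambda>x. a * f x + b * g x) s = a * orbit f s + b * orbit g s" for s
    using pos_functional_lincomb[OF pos_functional_P fg, of s a b] by (auto simp: orbit_def indicator_def)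
  then have "(\<lambda>s. indicator {0..T} s * orbit (\<lambda>x. a * f x + b * g x) s) =
      (\<lambda>s. a * (indicator {0..T} s * orbit f s) + b * (indicator {0..T} s * orbit g s))"
    by (simp add: algebra_simps)
  then show "avg T (\<lambda>x. a * f x + b * g x) = a * avg T f + b * avg T g"
    using assms fg by (simp add: avg_def orbit_integrable add_divide_distrib)
next
  fix f assume f: "ess_bounded M f" "AE x in M. 0 \<le> f x"
  have "0 \<le> orbit f s" for s
    using pos_functional_nonneg[OF pos_functional_P f, of s] by (auto simp: orbit_def indicator_def)
  then show "0 \<le> avg T f" using assms by (auto simp: avg_def intro!: divide_nonneg_pos integral_nonneg)
qed

lemma avg_one:
  assumes "0 < T" shows "avg T (\<lambda>_. 1) = measure M (space M)"
proof -
  have "AE s in lborel. indicator {0..T} s * orbit (\<lambda>_. 1) s = indicator {0..T} s * measure M (space M)"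
    using AE_lborel_singleton[of 0]
    by eventually_elim (auto simp: orbit_def integral_P_one indicator_def)
  then have "(\<integral>s. indicator {0..T} s * orbit (\<lambda>_. 1) s \<partial>lborel) =
      (\<integral>s. indicator {0..T} s * measure M (space M) \<partial>lborel)"
    using orbit_measurable[OF ess_bounded_const] by (intro integral_cong_AE) auto
  then show ?thesis using assms by (simp add: avg_def)
qed

lemma orbit_shift:
  assumes "0 < t" "0 < s" "ess_bounded M f"
  shows "orbit (P t f) s = orbit f (t + s)"
proof -
  have "(\<integral>x. P (s + t) f x \<partial>M) = (\<integral>x. P s (P t f) x \<partial>M)"
    using assms by (intro integral_cong_AE P_semigroup P_measurable P_ess_bounded) auto
  then show ?thesis using assms by (simp add: orbit_def add.commute)
qed

text \<open>By the semigroup law, applying \<open>P t\<close> moves the window [0,T] to [t,t+T]. The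
  windows differ only inside [0,t] and [T,t+T], also when t > T, and each piece contributes at most
  t C m(E).\<close>

lemma avg_shift:
  assumes t: "0 < t" and T: "0 < T" and f: "ess_bounded M f" "AE x in M. \<bar>f x\<bar> \<le> C" "0 \<le> C"
  shows "\<bar>avg T (P t f) - avg T f\<bar> \<le> 2 * t * C * measure M (space M) / T"
proof -
  let ?K = "C * measure M (space M)"
  note int = orbit_integrable[OF f(1)]
  have ind: "(\<integral>s. indicator {a..b} s * K \<partial>lborel) = (b - a) * K" if "a \<le> b" for a b K :: real
    using that by simp
  note [measurable] = orbit_measurable[OF f(1)] orbit_measurable[OF P_ess_bounded[OF t f(1)]]
  have "(\<integral>s. indicator {0..T} s * orbit (P t f) s \<partial>lborel) =
      (\<integral>s. indicator {t..t+T} (t + s) * orbit f (t + s) \<partial>lborel)"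
  proof (rule integral_cong_AE)
    show "AE s in lborel. indicator {0..T} s * orbit (P t f) s = indicator {t..t+T} (t + s) * orbit f (t + s)"
      using AE_lborel_singleton[of 0]
      by eventually_elim (use t orbit_shift[OF t _ f(1)] in \<open>auto simp: indicator_def\<close>)
  qed measurable
  also have "\<dots> = (\<integral>s. indicator {t..t+T} s * orbit f s \<partial>lborel)"
    using lborel_integral_real_affine[of 1 "\<lambda>s. indicator {t..t+T} s * orbit f s" t] by simp
  finally have eq: "(\<integral>s. indicator {0..T} s * orbit (P t f) s \<partial>lborel) -
      (\<integral>s. indicator {0..T} s * orbit f s \<partial>lborel) =
      (\<integral>s. indicator {t..t+T} s * orbit f s - indicator {0..T} s * orbit f s \<partial>lborel)"
    using int[of "{t..t+T}"] int[of "{0..T}"] t T by simp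
  have "\<bar>\<integral>s. indicator {t..t+T} s * orbit f s - indicator {0..T} s * orbit f s \<partial>lborel\<bar> \<le>
      (\<integral>s. indicator {0..t} s * ?K + indicator {T..t+T} s * ?K \<partial>lborel)"
  proof (rule integral_abs_bound_integral)
    fix s
    have "\<bar>indicator {t..t+T} s * orbit f s - indicator {0..T} s * orbit f s\<bar> =
        \<bar>indicator {t..t+T} s - indicator {0..T} s\<bar> * \<bar>orbit f s\<bar>"
      by (simp add: abs_mult left_diff_distrib[symmetric])
    also have "\<dots> \<le> (indicator {0..t} s + indicator {T..t+T} s) * ?K"
      using t T by (intro mult_mono orbit_bound f) (auto simp: indicator_def)
    finally show "\<bar>indicator {t..t+T} s * orbit f s - indicator {0..T} s * orbit f s\<bar>
        \<le> indicator {0..t} s * ?K + indicator {T..t+T} s * ?K"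
      by (simp add: algebra_simps)
  qed (use t T in \<open>auto intro!: int Bochner_Integration.integrable_diff\<close>)
  also have "\<dots> = (\<integral>s. indicator {0..t} s * ?K \<partial>lborel) + (\<integral>s. indicator {T..t+T} s * ?K \<partial>lborel)"
    using t T by (intro Bochner_Integration.integral_add) auto
  also have "\<dots> = t * ?K + t * ?K"
    using ind[of 0 t ?K] ind[of T "t + T" ?K] t by (simp only: less_imp_le[OF t] diff_zero add_diff_cancel_right' le_add_same_cancel2)
  also have "\<dots> = 2 * t * ?K" by simp
  finally have le: "\<bar>(\<integral>s. indicator {0..T} s * orbit (P t f) s \<partial>lborel) -
      (\<integral>s. indicator {0..T} s * orbit f s \<partial>lborel)\<bar> \<le> 2 * t * ?K"
    by (simp only: eq)
  have "avg T (P t f) - avg T f = ((\<integral>s. indicator {0..T} s * orbit (P t f) s \<partial>lborel) -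
      (\<integral>s. indicator {0..T} s * orbit f s \<partial>lborel)) / T"
    unfolding avg_def by (simp add: diff_divide_distrib)
  then have "\<bar>avg T (P t f) - avg T f\<bar> = \<bar>(\<integral>s. indicator {0..T} s * orbit (P t f) s \<partial>lborel) -
      (\<integral>s. indicator {0..T} s * orbit f s \<partial>lborel)\<bar> / T"
    using T by (simp only: abs_divide abs_of_pos)
  also have "\<dots> \<le> 2 * t * ?K / T" by (rule divide_right_mono[OF le]) (use T in simp)
  finally show ?thesis by (simp only: mult.assoc)
qed

text \<open>The shift error of the averages is of order 1 / \<open>tn n\<close>, so it disappears in
  the limit. The last clause is the channel through which a bound on \<open>cconst\<close> reaches
  \<Lambda>.\<close>

lemma invariant_functional:
  assumes tn: "incr_to_infinity tn"
  obtains \<Lambda> where "pos_functional M \<Lambda>" "\<Lambda> (\<lambda>_. 1) = measure M (space M)"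
    "\<And>t f. 0 < t \<Longrightarrow> ess_bounded M f \<Longrightarrow> \<Lambda> (P t f) = \<Lambda> f"
    "\<And>A c. A \<in> sets M \<Longrightarrow> (\<And>n. avgP M P (tn n) A \<le> c) \<Longrightarrow> \<Lambda> (indicator A) \<le> c"
proof -
  have pos: "\<And>n. 0 < tn n" and lim: "filterlim tn at_top sequentially"
    using tn by (auto simp: incr_to_infinity_def)
  note avg = pos_functional_avg[OF pos]
  \<comment> \<open>Setting the value to 0 off the essentially bounded functions gives a bound at
    every \<open>f\<close>, so that compactness applies to the product over all functions.\<close>
  define \<phi> where "\<phi> n f = (if ess_bounded M f then avg (tn n) f else 0)" for n f
  have "\<exists>b. \<forall>n. \<bar>\<phi> n f\<bar> \<le> b" for f
  proof (cases "ess_bounded M f")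
    case True
    then obtain C where "AE x in M. \<bar>f x\<bar> \<le> C" by (rule ess_boundedE)
    from pos_functional_bound[OF avg True this] show ?thesis
      using True by (auto simp: \<phi>_def avg_one[OF pos])
  qed (auto simp: \<phi>_def)
  then obtain B where "\<And>n f. \<bar>\<phi> n f\<bar> \<le> B f" by metis
  then obtain \<Lambda> G where G: "G \<noteq> bot" "G \<le> sequentially" and L: "\<And>f. ((\<lambda>n. \<phi> n f) \<longlongrightarrow> \<Lambda> f) G"
    using pointwise_bounded_cluster_filter[of \<phi> B] by blast
  have L': "((\<lambda>n. avg (tn n) f) \<longlongrightarrow> \<Lambda> f) G" if "ess_bounded M f" for f
    using L[of f] that by (simp add: \<phi>_def)
  show ?thesis
  proof
    show "pos_functional M \<Lambda>"
      unfolding pos_functional_def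
    proof (intro conjI allI impI)
      fix f g a b assume fg: "ess_bounded M f" "ess_bounded M g"
      have "((\<lambda>n. avg (tn n) (\<lambda>x. a * f x + b * g x)) \<longlongrightarrow> a * \<Lambda> f + b * \<Lambda> g) G"
        unfolding pos_functional_lincomb[OF avg fg] by (intro tendsto_intros L' fg)
      then show "\<Lambda> (\<lambda>x. a * f x + b * g x) = a * \<Lambda> f + b * \<Lambda> g"
        using L'[OF ess_bounded_lincomb[OF fg]] tendsto_unique[OF G(1)] by blast
    next
      fix f assume "ess_bounded M f" "AE x in M. 0 \<le> f x"
      then show "0 \<le> \<Lambda> f"
        using tendsto_lowerbound[OF L' _ G(1)] pos_functional_nonneg[OF avg] by (simp add: always_eventually)
    qed
    show "\<Lambda> (\<lambda>_. 1) = measure M (space M)"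
      using L'[OF ess_bounded_const[of M 1]] tendsto_unique[OF G(1)] by (simp add: avg_one[OF pos] tendsto_const_iff[OF G(1)])
  next
    fix t :: real and f assume t: "0 < t" and f: "ess_bounded M f"
    obtain C where C: "0 \<le> C" "AE x in M. \<bar>f x\<bar> \<le> C" using f by (rule ess_boundedE)
    have "(\<lambda>n. 2 * t * C * measure M (space M) / tn n) \<longlonglongrightarrow> 0"
      by (intro real_tendsto_divide_at_top[OF tendsto_const] lim)
    then have "(\<lambda>n. avg (tn n) (P t f) - avg (tn n) f) \<longlonglongrightarrow> 0"
      by (rule Lim_null_comparison[rotated])
        (auto intro!: always_eventually avg_shift[OF t pos f C(2,1)])
    then have "((\<lambda>n. avg (tn n) (P t f) - avg (tn n) f) \<longlongrightarrow> 0) G"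
      using G(2) tendsto_mono by blast
    moreover have "((\<lambda>n. avg (tn n) (P t f) - avg (tn n) f) \<longlongrightarrow> \<Lambda> (P t f) - \<Lambda> f) G"
      by (intro tendsto_diff L' f P_ess_bounded t)
    ultimately have "\<Lambda> (P t f) - \<Lambda> f = 0" using tendsto_unique[OF G(1)] by blast
    then show "\<Lambda> (P t f) = \<Lambda> f" by simp
  next
    fix A c assume A: "A \<in> sets M" and c: "\<And>n. avgP M P (tn n) A \<le> c"
    show "\<Lambda> (indicator A) \<le> c"
      using tendsto_upperbound[OF L'[OF ess_bounded_indicator[OF A]] _ G(1), of c] c
      by (simp add: avgP_eq[OF A] always_eventually)
  qed
qed

text \<open>Order continuity passes from \<open>M\<close> to \<open>N\<close> by Markov's
  inequality: the set where \<open>P t (indicator A)\<close> is at least \<open>a\<close> has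
  \<open>M\<close>-measure below \<eta>, hence small \<open>N\<close>-measure, and elsewhere the
  integrand is below \<open>a\<close>.\<close>

lemma P_small_absolutely_continuous:
  assumes N: "finite_measure N" "absolutely_continuous M N" "sets N = sets M"
    and t: "0 < t" and e: "0 < e"
  shows "\<exists>\<eta>>0. \<forall>A\<in>sets M. measure M A < \<eta> \<longrightarrow> (\<integral>x. P t (indicator A) x \<partial>N) < e"
proof -
  interpret N: finite_measure N by fact
  note LN = N.pos_functional_integral[OF N(2,3)]
  \<comment> \<open>Makes \<open>a\<close> times the total mass of \<open>N\<close> at most e/2; the
    added 1 avoids division by zero.\<close>
  define a where "a = e / (2 * (measure N (space N) + 1))"
  have den: "0 < measure N (space N) + 1" by (simp add: add_nonneg_pos)
  have a: "0 < a" using e den by (simp add: a_def)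
  have "a * measure N (space N) \<le> a * (measure N (space N) + 1)" using a by simp
  also have "\<dots> = e / 2" using den by (simp add: a_def field_simps)
  finally have aN: "a * measure N (space N) \<le> e / 2" .
  obtain \<eta> where \<eta>: "0 < \<eta>" "\<And>B. B \<in> sets M \<Longrightarrow> measure M B < \<eta> \<Longrightarrow> measure N B < e / 2"
    using absolutely_continuous_epsilon_delta[OF finite_measure_axioms N, of "e / 2"] e by auto
  obtain \<eta>' where \<eta>': "0 < \<eta>'"
    "\<And>A. A \<in> sets M \<Longrightarrow> measure M A < \<eta>' \<Longrightarrow> (\<integral>x. P t (indicator A) x \<partial>M) < a * \<eta>"
    using P_small[OF t, of "a * \<eta>"] a \<eta>(1) by auto
  have "(\<integral>x. P t (indicator A) x \<partial>N) < e" if A: "A \<in> sets M" "measure M A < \<eta>'" for A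
  proof -
    let ?g = "P t (indicator A)"
    have g: "ess_bounded M ?g" by (intro P_ess_bounded t ess_bounded_indicator A)
    note [measurable] = ess_bounded_measurable[OF g]
    define B where "B = {x \<in> space M. a \<le> ?g x}"
    have B: "B \<in> sets M" unfolding B_def by measurable
    have "(\<integral>x. a * indicator B x \<partial>M) \<le> (\<integral>x. ?g x \<partial>M)"
      using P_indicator[OF t A(1)] g B
      by (intro integral_mono_AE ess_bounded_integrable ess_bounded_cmult ess_bounded_indicator)
        (auto simp: B_def indicator_def)
    then have "a * measure M B < a * \<eta>" using \<eta>'(2)[OF A] B by simp
    then have "measure N B < e / 2" using a B by (intro \<eta>(2)) auto
    have "AE x in M. ?g x \<le> a + indicator B x"
      using P_indicator[OF t A(1)] AE_space
      by eventually_elim (use a in \<open>auto simp: B_def indicator_def\<close>)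
    then have "(\<integral>x. ?g x \<partial>N) \<le> (\<integral>x. a + indicator B x \<partial>N)"
      by (intro pos_functional_mono[OF LN] g ess_bounded_add ess_bounded_const ess_bounded_indicator B)
    also have "\<dots> = a * measure N (space N) + measure N B"
      using pos_functional_add[OF LN ess_bounded_const ess_bounded_indicator[OF B], of a] B N(3) by simp
    also have "\<dots> < e" using aN \<open>measure N B < e / 2\<close> by simp
    finally show ?thesis .
  qed
  with \<eta>'(1) show ?thesis by blast
qed

lemma invariant_measure_of_functional:
  assumes \<Lambda>: "pos_functional M \<Lambda>"
    and inv: "\<And>t f. 0 < t \<Longrightarrow> ess_bounded M f \<Longrightarrow> \<Lambda> (P t f) = \<Lambda> f"
    and c: "0 \<le> c" "c < \<Lambda> (\<lambda>_. 1)" and \<epsilon>: "0 < \<epsilon>"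
    and small: "\<And>A. A \<in> sets M \<Longrightarrow> measure M A < \<epsilon> \<Longrightarrow> \<Lambda> (indicator A) \<le> c"
  shows "\<exists>\<nu>. invariant_measure M P \<nu> \<and> absolutely_continuous M \<nu>"
proof -
  define \<nu> where "\<nu> = measure_of (space M) (sets M) (functional_outer M \<Lambda>)"
  have sets_\<nu>: "sets \<nu> = sets M" and space_\<nu>: "space \<nu> = space M" by (simp_all add: \<nu>_def)
  have em: "emeasure \<nu> A = functional_outer M \<Lambda> A" if "A \<in> sets M" for A
    using functional_outer_measure_space[OF \<Lambda>] that unfolding measure_space_def \<nu>_def
    by (intro emeasure_measure_of_sigma) auto
  have le: "emeasure \<nu> A \<le> ennreal (\<Lambda> (indicator A))" if "A \<in> sets M" for A
    using functional_outer_le[OF \<Lambda> that] em[OF that] by simp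
  have "emeasure \<nu> (space \<nu>) \<noteq> \<infinity>"
    using le[OF sets.top] by (auto simp: space_\<nu> top_unique)
  then interpret \<nu>: finite_measure \<nu> by (rule finite_measureI)
  have ac: "absolutely_continuous M \<nu>"
    unfolding absolutely_continuous_def
  proof
    fix A assume A: "A \<in> null_sets M"
    have "\<Lambda> (indicator A) = \<Lambda> (\<lambda>_. 0)"
      using A AE_not_in[OF A] by (intro pos_functional_cong[OF \<Lambda>] ess_bounded_indicator ess_bounded_const) auto
    then have "\<Lambda> (indicator A) = 0" using pos_functional_const[OF \<Lambda>, of 0] by simp
    with le[of A] A show "A \<in> null_sets \<nu>" by (simp add: null_sets_def sets_\<nu>)
  qed
  note L\<nu> = \<nu>.pos_functional_integral[OF ac sets_\<nu>]
  have L\<nu>_ind: "(\<integral>x. indicator A x \<partial>\<nu>) = measure \<nu> A" if "A \<in> sets M" for A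
    using that by (simp add: sets_\<nu>)
  have le': "(\<integral>x. indicator A x \<partial>\<nu>) \<le> \<Lambda> (indicator A)" if "A \<in> sets M" for A
    using le[OF that] pos_functional_indicator_nonneg[OF \<Lambda> that]
    unfolding L\<nu>_ind[OF that] by (simp add: \<nu>.emeasure_eq_measure)
  \<comment> \<open>\<open>functional_outer_lower\<close> with both functionals equal to \<Lambda>
    and the whole space as set: at most \<open>c\<close> of the mass \<Lambda> 1 can be
    lost.\<close>
  have "emeasure \<nu> (space \<nu>) \<noteq> 0"
  proof
    assume "emeasure \<nu> (space \<nu>) = 0"
    then have "ennreal (\<Lambda> (\<lambda>_. 1)) \<le> ennreal c"
      using functional_outer_lower[OF finite_measure_axioms \<Lambda> \<Lambda> order_refl c(1) \<epsilon> small sets.top]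
      by (simp add: em space_\<nu> pos_functional_indicator_space[OF \<Lambda>])
    with c show False by simp
  qed
  moreover have "(\<integral>x. P t f x \<partial>\<nu>) = (\<integral>x. f x \<partial>\<nu>)"
    if t: "0 < t" and f: "f \<in> borel_measurable M" "bounded (f ` space M)" for t f
  proof -
    let ?L = "\<lambda>f. \<integral>x. P t f x \<partial>\<nu>"
    have Lt: "pos_functional M ?L" by (rule pos_functional_comp[OF L\<nu> t])
    have Lt_one: "?L (\<lambda>_. 1) = measure \<nu> (space M)"
    proof -
      have "?L (\<lambda>_. 1) = (\<integral>x. 1 \<partial>\<nu>)"
        by (intro pos_functional_cong[OF L\<nu>] P_ess_bounded t ess_bounded_const P_one)
      then show ?thesis by (simp add: space_\<nu>)
    qed
    have below: "?L (indicator A) \<le> \<Lambda> (indicator A)" if A: "A \<in> sets M" for A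
    proof -
      have "?L (indicator A) \<le> \<Lambda> (P t (indicator A))"
        using P_indicator[OF t A]
        by (intro pos_functional_le[OF L\<nu> \<Lambda> le'] P_ess_bounded t ess_bounded_indicator A) auto
      then show ?thesis using inv[OF t ess_bounded_indicator[OF A]] by simp
    qed
    \<comment> \<open>Maximality of \<nu>. Order continuity makes \<open>?L\<close> small on small
      sets, so \<open>functional_outer_lower\<close> applies with every positive error
      \<open>e\<close>.\<close>
    have sub: "?L (indicator A) \<le> measure \<nu> A" if A: "A \<in> sets M" for A
    proof -
      have "ennreal (?L (indicator A)) \<le> functional_outer M \<Lambda> A"
      proof (rule ennreal_le_epsilon)
        fix e :: real assume "0 < e"
        then obtain \<eta> where "0 < \<eta>" "\<And>B. B \<in> sets M \<Longrightarrow> measure M B < \<eta> \<Longrightarrow> ?L (indicator B) < e"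
          using P_small_absolutely_continuous[OF \<nu>.finite_measure_axioms ac sets_\<nu> t] by blast
        then show "ennreal (?L (indicator A)) \<le> functional_outer M \<Lambda> A + ennreal e"
          using \<open>0 < e\<close> by (intro functional_outer_lower[OF finite_measure_axioms Lt \<Lambda> below _ _ _ A]) (auto intro: less_imp_le)
      qed
      then show ?thesis by (simp add: em[OF A, symmetric] \<nu>.emeasure_eq_measure)
    qed
    \<comment> \<open>\<open>sub\<close> holds for \<open>A\<close> and for its complement, and the
      total masses agree because P_t 1 = 1; so neither inequality is strict.\<close>
    have eq: "?L (indicator A) = (\<integral>x. indicator A x \<partial>\<nu>)" if A: "A \<in> sets M" for A
    proof -
      have "?L (indicator A) + ?L (indicator (space M - A)) = ?L (indicator (A \<union> (space M - A)))"
        using A by (intro pos_functional_indicator_Un[OF Lt, symmetric]) auto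
      also have "A \<union> (space M - A) = space M" using sets.sets_into_space[OF A] by auto
      finally have "?L (indicator A) + ?L (indicator (space M - A)) = measure \<nu> (space M)"
        using pos_functional_indicator_space[OF Lt] Lt_one by simp
      moreover have "measure \<nu> (space M - A) = measure \<nu> (space M) - measure \<nu> A"
        using \<nu>.finite_measure_compl[of A] A by (simp add: sets_\<nu> space_\<nu>)
      ultimately show ?thesis
        using sub[OF A] sub[of "space M - A"] A unfolding L\<nu>_ind[OF A] by simp
    qed
    obtain C where C: "\<And>x. x \<in> space M \<Longrightarrow> \<bar>f x\<bar> \<le> C" using f(2) by (auto simp: bounded_iff)
    have eb: "ess_bounded M f" using f(1) C by (intro ess_boundedI[of _ _ C]) auto
    \<comment> \<open>\<open>pos_functional_le\<close> compares nonnegative functions only, hence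
      the shift by \<open>C\<close>, which is removed again by linearity.\<close>
    have ebC: "ess_bounded M (\<lambda>x. f x + C)" by (intro ess_bounded_add eb ess_bounded_const)
    have nn: "AE x in M. 0 \<le> f x + C" using C by (intro AE_I2) (auto simp: abs_le_iff dest!: C)
    have "?L (\<lambda>x. f x + C) = (\<integral>x. f x + C \<partial>\<nu>)"
      using eq by (intro antisym pos_functional_le[OF Lt L\<nu> _ ebC nn] pos_functional_le[OF L\<nu> Lt _ ebC nn]) auto
    then show ?thesis
      using pos_functional_add[OF Lt eb ess_bounded_const] pos_functional_add[OF L\<nu> eb ess_bounded_const]
        pos_functional_const[OF Lt, of C] Lt_one pos_functional_const[OF L\<nu>, of C] by (simp add: space_\<nu>)
  qed
  ultimately have "invariant_measure M P \<nu>"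
    unfolding invariant_measure_def using sets_\<nu> \<nu>.finite_measure_axioms by blast
  with ac show ?thesis by blast
qed

section \<open>From an absolutely continuous invariant measure to almost invariance\<close>

lemma almost_invariant_of_invariant_measure:
  assumes inv: "invariant_measure M P \<nu>" and ac: "absolutely_continuous M \<nu>"
  shows "almost_invariant M P"
proof -
  have sets_\<nu>: "sets \<nu> = sets M" and "finite_measure \<nu>" and nz: "emeasure \<nu> (space \<nu>) \<noteq> 0"
    using inv by (auto simp: invariant_measure_def)
  have P: "(\<integral>x. P t (indicator A) x \<partial>\<nu>) = measure \<nu> A" if "0 < t" "A \<in> sets M" for t A
  proof -
    have "bounded ((indicator A :: 'a \<Rightarrow> real) ` space M)"
      by (rule boundedI[of _ 1]) (auto simp: indicator_def)
    then have "(\<integral>x. P t (indicator A) x \<partial>\<nu>) = (\<integral>x. indicator A x \<partial>\<nu>)"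
      using inv that unfolding invariant_measure_def by simp
    then show ?thesis using that sets_\<nu> by simp
  qed
  interpret \<nu>: finite_measure \<nu> by fact
  have space_\<nu>: "space \<nu> = space M" using sets_\<nu> by (rule sets_eq_imp_space_eq)
  obtain f where f[measurable]: "f \<in> borel_measurable M" and \<nu>: "density M f = \<nu>"
    using Radon_Nikodym[OF ac sets_\<nu>] by blast
  \<comment> \<open>If all these sets were null, the density would vanish almost everywhere and
    \<nu> would be 0.\<close>
  have "\<exists>n. measure M {x \<in> space M. 1 < of_nat n * f x} \<noteq> 0"
  proof (rule ccontr)
    assume "\<not> ?thesis"
    then have "AE x in M. \<not> 1 < of_nat n * f x" for n :: nat
      by (subst AE_iff_measurable[OF _ refl]) (auto simp: emeasure_eq_measure)
    then have "AE x in M. \<forall>n::nat. \<not> 1 < of_nat n * f x" by (simp add: AE_all_countable)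
    then have "AE x in M. f x = 0"
    proof eventually_elim
      case (elim x)
      show ?case
      proof (rule ccontr)
        assume "f x \<noteq> 0"
        \<comment> \<open>The density takes values in \<open>ennreal\<close>; where it is infinite,
          n = 1 works.\<close>
        have "\<exists>n::nat. 1 < of_nat n * f x"
        proof (cases "f x")
          case (real r)
          with \<open>f x \<noteq> 0\<close> have "0 < r" by auto
          obtain n :: nat where "1 / r < n" using reals_Archimedean2 by blast
          with \<open>0 < r\<close> have "ennreal 1 < ennreal (n * r)"
            by (intro ennreal_lessI) (auto simp: pos_divide_less_eq)
          then show ?thesis
            using \<open>0 < r\<close> by (auto simp: real ennreal_mult ennreal_of_nat_eq_real_of_nat)
        next
          case top
          then show ?thesis by (intro exI[of _ 1]) simp
        qed
        with elim show False by blast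
      qed
    qed
    then have "emeasure \<nu> (space M) = 0"
      by (simp add: \<nu>[symmetric] emeasure_density nn_integral_0_iff_AE)
    with nz space_\<nu> show False by simp
  qed
  then obtain n :: nat where n: "measure M {x \<in> space M. 1 < of_nat n * f x} \<noteq> 0" by blast
  define F where "F = {x \<in> space M. 1 < of_nat n * f x}"
  have F: "F \<in> sets M" and F0: "0 < measure M F"
    using n by (simp_all add: F_def zero_less_measure_iff)
  then have m0: "0 < measure M (space M)"
    using finite_measure_mono[of F "space M"] sets.sets_into_space[OF F] by simp
  \<comment> \<open>Chosen so that \<delta> m(E) is the mass of the complement of \<open>F\<close>;
    it is below 1 exactly because \<open>F\<close> has positive mass.\<close>
  define \<delta> where "\<delta> = measure M (space M - F) / measure M (space M)"
  have \<delta>: "0 \<le> \<delta>" "\<delta> < 1"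
    using F0 m0 by (simp add: \<delta>_def) (use F0 m0 finite_measure_compl[OF F] in \<open>simp add: \<delta>_def\<close>)
  have "mP M P t A \<le> \<delta> * measure M (space M) + n * measure \<nu> A" if t: "0 < t" and A: "A \<in> sets M" for t A
  proof -
    let ?g = "P t (indicator A)"
    have g: "ess_bounded M ?g" by (intro P_ess_bounded t ess_bounded_indicator A)
    note [measurable] = ess_bounded_measurable[OF g] F
    have g01: "AE x in M. 0 \<le> ?g x \<and> ?g x \<le> 1" by (rule P_indicator[OF t A])
    have g01': "AE x in \<nu>. 0 \<le> ?g x \<and> ?g x \<le> 1" by (rule absolutely_continuous_AE[OF sets_\<nu> ac g01])
    \<comment> \<open>Off \<open>F\<close> the function is at most 1; on \<open>F\<close> it is at
      most n f times itself, which integrates to n times its \<nu>-integral, and that integral is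
      \<nu>(A) by invariance for every \<open>t\<close>.\<close>
    have "AE x in M. ennreal (?g x) \<le> indicator (space M - F) x + of_nat n * (f x * ennreal (?g x))"
      using g01 AE_space
    proof eventually_elim
      case (elim x)
      show ?case
      proof (cases "x \<in> F")
        case True
        then have "1 \<le> of_nat n * f x" by (auto simp: F_def intro: less_imp_le)
        then have "1 * ennreal (?g x) \<le> of_nat n * f x * ennreal (?g x)" by (rule mult_right_mono) simp
        then show ?thesis using True by (simp add: mult.assoc)
      next
        case False
        then show ?thesis using elim by (auto intro!: add_increasing2)
      qed
    qed
    have "ennreal (mP M P t A) = (\<integral>\<^sup>+ x. ennreal (?g x) \<partial>M)"
      unfolding mP_def using g01 ess_bounded_integrable[OF g]
      by (intro nn_integral_eq_integral[symmetric]) auto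
    also have "\<dots> \<le> (\<integral>\<^sup>+ x. indicator (space M - F) x + of_nat n * (f x * ennreal (?g x)) \<partial>M)"
      by (rule nn_integral_mono_AE) fact
    also have "\<dots> = emeasure M (space M - F) + of_nat n * (\<integral>\<^sup>+ x. ennreal (?g x) \<partial>\<nu>)"
      by (simp add: nn_integral_add nn_integral_cmult nn_integral_density \<nu>[symmetric])
    also have "(\<integral>\<^sup>+ x. ennreal (?g x) \<partial>\<nu>) = ennreal (\<integral>x. ?g x \<partial>\<nu>)"
    proof (rule nn_integral_eq_integral)
      show "integrable \<nu> ?g"
        using g01' ess_bounded_measurable[OF g] sets_\<nu>
        by (intro \<nu>.integrable_const_bound[of _ 1]) (auto cong: measurable_cong_sets)
    qed (use g01' in auto)
    also have "\<dots> = ennreal (measure \<nu> A)" by (simp add: P[OF t A])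
    also have "emeasure M (space M - F) + of_nat n * ennreal (measure \<nu> A) =
        ennreal (measure M (space M - F) + n * measure \<nu> A)"
      by (simp add: emeasure_eq_measure ennreal_mult ennreal_of_nat_eq_real_of_nat)
    finally have "mP M P t A \<le> measure M (space M - F) + n * measure \<nu> A"
      by (rule ennreal_le_iff[THEN iffD1, rotated]) simp
    then show ?thesis using m0 by (simp add: \<delta>_def)
  qed
  moreover have "vanishing_setfun M (\<lambda>A. n * measure \<nu> A)"
    unfolding vanishing_setfun_def
  proof (intro conjI allI impI ballI)
    fix e :: real assume e: "0 < e"
    obtain \<eta> where \<eta>: "0 < \<eta>" "\<And>A. A \<in> sets M \<Longrightarrow> measure M A < \<eta> \<Longrightarrow> measure \<nu> A < e / (n + 1)"
      using absolutely_continuous_epsilon_delta[OF finite_measure_axioms \<nu>.finite_measure_axioms ac sets_\<nu>, of "e / (n+1)"] e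
      by auto
    have "n * measure \<nu> A < e" if "A \<in> sets M" "measure M A < \<eta>" for A
    proof -
      have "n * measure \<nu> A \<le> (n + 1) * measure \<nu> A" by (simp add: mult_right_mono)
      also have "\<dots> < e" using \<eta>(2)[OF that] by (simp add: pos_less_divide_eq mult.commute)
      finally show ?thesis .
    qed
    with \<eta>(1) show "\<exists>\<eta>>0. \<forall>A\<in>sets M. measure M A < \<eta> \<longrightarrow> n * measure \<nu> A < e" by blast
  qed simp
  ultimately show ?thesis unfolding almost_invariant_def using \<delta> by blast
qed

end

subsection \<open>Equivalence of the conditions\<close>

text \<open>\<open>Lim\<close> is a definite description, so the limit must be shown to exist.
  Monotonicity yields it as an infimum, and the supremum in \<open>cconst\<close> is monotone
  because a larger \<epsilon> admits more sets.\<close>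

lemma Lim_at_right_mono:
  fixes G :: "real \<Rightarrow> ereal"
  assumes mono: "\<And>x y. 0 < x \<Longrightarrow> x \<le> y \<Longrightarrow> G x \<le> G y"
  shows "Lim (at_right 0) G = (INF x\<in>{0<..}. G x)"
proof (rule tendsto_Lim)
  show "(G \<longlongrightarrow> (INF x\<in>{0<..}. G x)) (at_right 0)"
  proof (rule order_tendstoI)
    fix a assume a: "a < (INF x\<in>{0<..}. G x)"
    have "a < G x" if "0 < x" for x
      using a that by (auto intro: less_le_trans INF_lower)
    then show "eventually (\<lambda>x. a < G x) (at_right 0)"
      by (auto intro: eventually_mono[OF eventually_at_right_less])
  next
    fix a assume "(INF x\<in>{0<..}. G x) < a"
    then obtain x0 where x0: "0 < x0" "G x0 < a" by (auto simp: INF_less_iff)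
    have "eventually (\<lambda>x. x \<in> {0<..<x0}) (at_right 0)"
      using x0(1) by (rule eventually_at_right_real)
    then show "eventually (\<lambda>x. G x < a) (at_right 0)"
    proof eventually_elim
      case (elim x)
      then have "G x \<le> G x0" by (intro mono) auto
      then show ?case using x0(2) by (rule le_less_trans)
    qed
  qed
qed simp

definition small_sup :: "'a measure \<Rightarrow> (real \<Rightarrow> ('a \<Rightarrow> real) \<Rightarrow> 'a \<Rightarrow> real) \<Rightarrow> (nat \<Rightarrow> real) \<Rightarrow> real \<Rightarrow> ereal" where
  "small_sup M P tn \<epsilon> = (SUP A \<in> {A \<in> sets M. measure M A \<le> \<epsilon>}. SUP n. ereal (avgP M P (tn n) A))"

lemma cconst_eq_INF: "cconst M P tn = (INF \<epsilon>\<in>{0<..}. small_sup M P tn \<epsilon>)"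
  unfolding cconst_def small_sup_def[symmetric]
  by (rule Lim_at_right_mono) (auto simp: small_sup_def intro!: SUP_subset_mono)

lemma cconst_less_of_mean_almost_invariant:
  assumes "0 < measure M (space M)" and mai: "mean_almost_invariant M P tn"
  shows "cconst M P tn < ereal (measure M (space M))"
proof -
  let ?m = "measure M (space M)"
  obtain \<delta> \<phi> where \<delta>: "\<delta> < 1" and \<phi>: "vanishing_setfun M \<phi>"
    and le: "\<And>n A. A \<in> sets M \<Longrightarrow> avgP M P (tn n) A \<le> \<delta> * ?m + \<phi> A"
    using mai by (auto simp: mean_almost_invariant_def)
  \<comment> \<open>Half of the gap between \<delta> m(E) and m(E).\<close>
  define e where "e = (1 - \<delta>) * ?m / 2"
  have e: "0 < e" "\<delta> * ?m + e < ?m"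
  proof -
    have "0 < (1 - \<delta>) * ?m" using assms(1) \<delta> by simp
    then show "0 < e" "\<delta> * ?m + e < ?m" by (simp_all add: e_def field_simps)
  qed
  obtain \<eta> where \<eta>: "0 < \<eta>" "\<And>A. A \<in> sets M \<Longrightarrow> measure M A < \<eta> \<Longrightarrow> \<phi> A < e"
    using \<phi> e(1) unfolding vanishing_setfun_def by blast
  \<comment> \<open>Half of \<eta> turns the weak inequality on \<open>measure M A\<close> into the
    strict one that the vanishing of \<phi> requires.\<close>
  have "cconst M P tn \<le> small_sup M P tn (\<eta> / 2)"
    unfolding cconst_eq_INF by (rule INF_lower) (use \<eta>(1) in simp)
  also have "\<dots> \<le> ereal (\<delta> * ?m + e)"
    unfolding small_sup_def
  proof (intro SUP_least)
    fix A n assume "A \<in> {A \<in> sets M. measure M A \<le> \<eta> / 2}"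
    then have "A \<in> sets M" "measure M A < \<eta>" using \<eta>(1) by auto
    with le[of A n] \<eta>(2)[of A] show "ereal (avgP M P (tn n) A) \<le> ereal (\<delta> * ?m + e)" by simp
  qed
  also have "\<dots> < ereal ?m" using e(2) by simp
  finally show ?thesis .
qed

context ess_markov_semigroup
begin

lemma mean_almost_invariant_of_almost_invariant:
  assumes "almost_invariant M P" and tn: "incr_to_infinity tn"
  shows "mean_almost_invariant M P tn"
proof -
  obtain \<delta> \<phi> where \<delta>: "0 \<le> \<delta>" "\<delta> < 1" and \<phi>: "vanishing_setfun M \<phi>"
    and le: "\<And>t A. 0 < t \<Longrightarrow> A \<in> sets M \<Longrightarrow> mP M P t A \<le> \<delta> * measure M (space M) + \<phi> A"
    using assms(1) by (auto simp: almost_invariant_def)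
  have "avgP M P (tn n) A \<le> \<delta> * measure M (space M) + \<phi> A" if A: "A \<in> sets M" for n A
  proof -
    let ?K = "\<delta> * measure M (space M) + \<phi> A"
    have T: "0 < tn n" using tn by (simp add: incr_to_infinity_def)
    \<comment> \<open>Needed at time 0, where \<open>orbit\<close> is 0 and almost invariance says
      nothing.\<close>
    have K: "0 \<le> ?K" using \<delta>(1) \<phi> A by (simp add: vanishing_setfun_def)
    have "orbit (indicator A) s \<le> ?K" for s
      using K le[of s A] A by (auto simp: orbit_def mP_def indicator_def)
    moreover have int: "integrable lborel (\<lambda>s. indicator {0..tn n} s * ?K)"
      using T by (intro integrable_mult_left integrable_real_indicator) auto
    ultimately have "(\<integral>s. indicator {0..tn n} s * orbit (indicator A) s \<partial>lborel) \<le> (\<integral>s. indicator {0..tn n} s * ?K \<partial>lborel)"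
      using T int by (intro integral_mono orbit_integrable ess_bounded_indicator A) (auto simp: indicator_def)
    also have "\<dots> = tn n * ?K" using T by simp
    finally show ?thesis using T by (simp add: avgP_eq[OF A] avg_def pos_divide_le_eq mult.commute)
  qed
  with \<delta> \<phi> show ?thesis unfolding mean_almost_invariant_def by blast
qed

lemma invariant_measure_of_cconst_less:
  assumes tn: "incr_to_infinity tn" and c: "cconst M P tn < ereal (measure M (space M))"
  shows "\<exists>\<nu>. invariant_measure M P \<nu> \<and> absolutely_continuous M \<nu>"
proof -
  obtain \<epsilon> where \<epsilon>: "0 < \<epsilon>" and less: "small_sup M P tn \<epsilon> < ereal (measure M (space M))"
    using c by (auto simp: cconst_eq_INF INF_less_iff)
  have upper: "ereal (avgP M P (tn n) A) \<le> small_sup M P tn \<epsilon>" if "A \<in> sets M" "measure M A \<le> \<epsilon>" for n A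
    unfolding small_sup_def using that by (auto intro!: SUP_upper2[of A] SUP_upper2[of n])
  have T: "0 < tn 0" using tn by (simp add: incr_to_infinity_def)
  \<comment> \<open>The empty set is always admissible, so the extended real supremum is
    nonnegative; being also below m(E), it is a real number \<open>r\<close>.\<close>
  have "0 \<le> avgP M P (tn 0) {}"
    by (simp add: avgP_eq pos_functional_indicator_nonneg[OF pos_functional_avg[OF T]])
  then have "0 \<le> small_sup M P tn \<epsilon>"
    using upper[of "{}" 0] \<epsilon> by (auto intro: order_trans[rotated])
  with less obtain r where r: "small_sup M P tn \<epsilon> = ereal r" "0 \<le> r" "r < measure M (space M)"
    by (cases "small_sup M P tn \<epsilon>") auto
  obtain \<Lambda> where \<Lambda>: "pos_functional M \<Lambda>" "\<Lambda> (\<lambda>_. 1) = measure M (space M)"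
    "\<And>t f. 0 < t \<Longrightarrow> ess_bounded M f \<Longrightarrow> \<Lambda> (P t f) = \<Lambda> f"
    "\<And>A c. A \<in> sets M \<Longrightarrow> (\<And>n. avgP M P (tn n) A \<le> c) \<Longrightarrow> \<Lambda> (indicator A) \<le> c"
    using invariant_functional[OF tn] by blast
  show ?thesis
  proof (rule invariant_measure_of_functional[OF \<Lambda>(1,3)])
    show "\<Lambda> (indicator A) \<le> r" if "A \<in> sets M" "measure M A < \<epsilon>" for A
      using upper[of A] that r(1) by (intro \<Lambda>(4)) (auto simp: less_imp_le)
  qed (use r \<epsilon> \<Lambda>(2) in auto)
qed

lemma invariant_measure_equivalences:
  assumes nz: "emeasure M (space M) \<noteq> 0"
  shows "((\<exists>\<nu>. invariant_measure M P \<nu> \<and> absolutely_continuous M \<nu>) \<longleftrightarrow> almost_invariant M P)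
    \<and> (almost_invariant M P \<longleftrightarrow>
         (\<forall>tn. incr_to_infinity tn \<longrightarrow> mean_almost_invariant M P tn))
    \<and> ((\<forall>tn. incr_to_infinity tn \<longrightarrow> mean_almost_invariant M P tn) \<longleftrightarrow>
         (\<forall>tn. incr_to_infinity tn \<longrightarrow> cconst M P tn < ereal (measure M (space M))))
    \<and> ((\<forall>tn. incr_to_infinity tn \<longrightarrow> cconst M P tn < ereal (measure M (space M))) \<longleftrightarrow>
         (\<exists>tn. incr_to_infinity tn \<and> cconst M P tn < ereal (measure M (space M))))"
proof -
  have m: "0 < measure M (space M)" using nz by (simp add: emeasure_eq_measure zero_less_measure_iff)
  \<comment> \<open>A concrete admissible sequence, without which (iv) could not give (v).\<close>
  have "incr_to_infinity (\<lambda>n. real (Suc n))"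
    unfolding incr_to_infinity_def
    using filterlim_compose[OF filterlim_real_sequentially filterlim_Suc] by (simp add: incseq_def del: of_nat_Suc)
  then show ?thesis
    using almost_invariant_of_invariant_measure mean_almost_invariant_of_almost_invariant
      cconst_less_of_mean_almost_invariant[OF m] invariant_measure_of_cconst_less by blast
qed

end

subsection \<open>Transition functions\<close>

context
  fixes M :: "'a measure" and K
  assumes fin: "finite_measure M" and K: "markov_transition_function M K"
begin

interpretation finite_measure M by (rule fin)

lemma kernel_measurable: "0 \<le> t \<Longrightarrow> K t \<in> M \<rightarrow>\<^sub>M subprob_algebra M"
  using K by (auto simp: markov_transition_function_def intro: measurable_prob_algebraD)

lemma kernel_prob_space:
  assumes "0 \<le> t" "x \<in> space M"
  shows "prob_space (K t x)" "sets (K t x) = sets M" "space (K t x) = space M"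
proof -
  have "K t \<in> M \<rightarrow>\<^sub>M prob_algebra M" using K assms(1) by (simp add: markov_transition_function_def)
  from measurable_space[OF this assms(2)] show "prob_space (K t x)" "sets (K t x) = sets M"
    by (auto simp: space_prob_algebra)
  then show "space (K t x) = space M" by (metis sets_eq_imp_space_eq)
qed

lemma kernel_nn_integral_measurable:
  "0 \<le> t \<Longrightarrow> f \<in> borel_measurable M \<Longrightarrow> (\<lambda>x. \<integral>\<^sup>+ y. f y \<partial>K t x) \<in> borel_measurable M"
  by (rule measurable_compose[OF kernel_measurable nn_integral_measurable_subprob_algebra])

lemma kernel_op_measurable:
  "0 \<le> t \<Longrightarrow> f \<in> borel_measurable M \<Longrightarrow> kernel_op K t f \<in> borel_measurable M"
  unfolding kernel_op_def[abs_def]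
  by (rule measurable_compose[OF kernel_measurable integral_measurable_subprob_algebra])

text \<open>The null-set condition applied to the indicator of an exceptional set: from almost every
  starting point the kernel does not charge it. This makes the kernel operators respect equality
  almost everywhere.\<close>

lemma kernel_AE:
  assumes t: "0 < t" and Q: "AE y in M. Q y"
  shows "AE x in M. AE y in K t x. Q y"
proof -
  obtain N where N: "N \<in> null_sets M" "{x \<in> space M. \<not> Q x} \<subseteq> N"
    using Q by (auto simp: eventually_ae_filter)
  have "(\<integral>\<^sup>+ x. (\<integral>\<^sup>+ y. indicator N y \<partial>K t x) \<partial>M) = 0"
    using K t N(1) unfolding markov_transition_function_def
    by (auto simp: null_sets_def)
  then have "AE x in M. (\<integral>\<^sup>+ y. indicator N y \<partial>K t x) = 0"
    using kernel_nn_integral_measurable[of t "indicator N"] t N(1) by (subst (asm) nn_integral_0_iff_AE) auto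
  then show ?thesis
    using AE_space
  proof eventually_elim
    case (elim x)
    note p = kernel_prob_space[OF less_imp_le[OF t] elim(2)]
    have "emeasure (K t x) N = 0" using elim(1) N(1) p(2) by (simp add: null_sets_def)
    then have "N \<in> null_sets (K t x)" using N(1) p(2) by (simp add: null_sets_def)
    then show ?case using N(2) p(3) by (auto simp: eventually_ae_filter)
  qed
qed

lemma kernel_AE_integrable:
  assumes t: "0 < t" and f: "ess_bounded M f"
  shows "AE x in M. integrable (K t x) f"
proof -
  obtain C where C: "AE x in M. \<bar>f x\<bar> \<le> C" using f by (rule ess_boundedE)
  show ?thesis
    using kernel_AE[OF t C] AE_space
  proof eventually_elim
    case (elim x)
    note p = kernel_prob_space[OF less_imp_le[OF t] elim(2)]
    interpret prob_space "K t x" by (rule p(1))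
    show ?case
      using elim(1) ess_bounded_measurable[OF f] p(2)
      by (intro integrable_const_bound[of _ C]) (auto cong: measurable_cong_sets)
  qed
qed

lemma kernel_op_cong_AE:
  assumes t: "0 < t" and fg: "f \<in> borel_measurable M" "g \<in> borel_measurable M" "AE x in M. f x = g x"
  shows "AE x in M. kernel_op K t f x = kernel_op K t g x"
  using kernel_AE[OF t fg(3)] AE_space
proof eventually_elim
  case (elim x)
  note p = kernel_prob_space[OF less_imp_le[OF t] elim(2)]
  show ?case unfolding kernel_op_def
    using elim(1) fg(1,2) p(2) by (intro integral_cong_AE) (auto cong: measurable_cong_sets)
qed

text \<open>The Chapman-Kolmogorov equation on sets says that K (t + s) x is the monadic composition
  of K t x with K s; integration against a composed kernel then covers functions bounded
  everywhere.\<close>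

lemma kernel_op_semigroup_bounded:
  assumes st: "0 \<le> s" "0 \<le> t" and g: "g \<in> borel_measurable M" "\<And>x. \<bar>g x\<bar> \<le> C" and x: "x \<in> space M"
  shows "kernel_op K (t + s) g x = kernel_op K t (kernel_op K s g) x"
proof -
  note p = kernel_prob_space[OF st(2) x]
  interpret prob_space "K t x" by (rule p(1))
  have Ks: "K s \<in> K t x \<rightarrow>\<^sub>M subprob_algebra M"
    using kernel_measurable[OF st(1)] by (simp cong: measurable_cong_sets add: p(2))
  have "K (t + s) x = bind (K t x) (K s)"
  proof (rule measure_eqI)
    show "sets (K (t + s) x) = sets (bind (K t x) (K s))"
      using kernel_prob_space(2)[OF _ x, of "t + s"] st sets_bind[OF sets_kernel[OF Ks] not_empty] by simp
    fix A assume "A \<in> sets (K (t + s) x)"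
    then have A: "A \<in> sets M" using kernel_prob_space(2)[OF _ x, of "t + s"] st by simp
    have "emeasure (K (t + s) x) A = (\<integral>\<^sup>+ y. emeasure (K s y) A \<partial>K t x)"
      using K st x A unfolding markov_transition_function_def by blast
    then show "emeasure (K (t + s) x) A = emeasure (bind (K t x) (K s)) A"
      using emeasure_bind[OF not_empty Ks A] by simp
  qed
  moreover have "AE y in K t x. emeasure (K s y) (space (K s y)) \<le> ennreal 1"
    by (intro AE_I2) (simp add: p(3) prob_space.emeasure_space_1[OF kernel_prob_space(1)[OF st(1)]])
  ultimately show ?thesis
    unfolding kernel_op_def using integral_bind[OF g(1,2) Ks finite_measure_axioms, where B' = 1] by simp
qed

text \<open>Truncating \<open>f\<close> at its essential bound changes it only on a null set, which
  the kernels do not see from almost every point, so the case of an everywhere bounded function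
  applies.\<close>

lemma kernel_op_semigroup:
  assumes st: "0 < s" "0 < t" and f: "ess_bounded M f"
  shows "AE x in M. kernel_op K (t + s) f x = kernel_op K t (kernel_op K s f) x"
proof -
  obtain C where C: "0 \<le> C" "AE x in M. \<bar>f x\<bar> \<le> C" using f by (rule ess_boundedE)
  note [measurable] = ess_bounded_measurable[OF f]
  define g where "g x = max (- C) (min C (f x))" for x
  have g: "g \<in> borel_measurable M" unfolding g_def by measurable
  have gC: "\<bar>g x\<bar> \<le> C" for x using C(1) by (auto simp: g_def)
  have fg: "AE x in M. f x = g x" using C(2) by eventually_elim (auto simp: g_def)
  have "AE x in M. kernel_op K t (kernel_op K s f) x = kernel_op K t (kernel_op K s g) x"
    using st g f by (intro kernel_op_cong_AE kernel_op_measurable fg) auto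
  moreover have "AE x in M. kernel_op K (t + s) f x = kernel_op K (t + s) g x"
    using st g by (intro kernel_op_cong_AE fg) auto
  ultimately show ?thesis using AE_space
    by eventually_elim (use kernel_op_semigroup_bounded[OF _ _ g gC] st in auto)
qed

text \<open>A |-> m(K_t 1_A) is a finite measure, here built as \<open>N\<close>, and it is
  absolutely continuous by the null-set condition; the epsilon-delta form of absolute continuity is
  the claim.\<close>

lemma kernel_small:
  assumes t: "0 < t" and e: "0 < e"
  shows "\<exists>\<eta>>0. \<forall>A\<in>sets M. measure M A < \<eta> \<longrightarrow> (\<integral>x. kernel_op K t (indicator A) x \<partial>M) < e"
proof -
  define \<mu> where "\<mu> A = (\<integral>\<^sup>+ x. emeasure (K t x) A \<partial>M)" for A
  define N where "N = measure_of (space M) (sets M) \<mu>"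
  have meas: "(\<lambda>x. emeasure (K t x) A) \<in> borel_measurable M" if "A \<in> sets M" for A
    using measurable_compose[OF kernel_measurable measurable_emeasure_subprob_algebra[OF that]] t by simp
  have N: "emeasure N A = \<mu> A" if "A \<in> sets M" for A
    unfolding N_def
  proof (rule emeasure_measure_of_sigma[OF sets.sigma_algebra_axioms _ _ that])
    show "positive (sets M) \<mu>" by (simp add: positive_def \<mu>_def)
    show "countably_additive (sets M) \<mu>"
      unfolding countably_additive_def
    proof (intro allI impI)
      fix A :: "nat \<Rightarrow> 'a set" assume A: "range A \<subseteq> sets M" "disjoint_family A"
      have "(\<Sum>i. \<mu> (A i)) = (\<integral>\<^sup>+ x. (\<Sum>i. emeasure (K t x) (A i)) \<partial>M)"
        unfolding \<mu>_def using A(1) by (intro nn_integral_suminf[symmetric] meas) auto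
      also have "\<dots> = \<mu> (\<Union>i. A i)"
        unfolding \<mu>_def using A kernel_prob_space(2)[of t] t
        by (intro nn_integral_cong suminf_emeasure) auto
      finally show "(\<Sum>i. \<mu> (A i)) = \<mu> (\<Union>i. A i)" .
    qed
  qed
  have sets_N: "sets N = sets M" and space_N: "space N = space M" by (simp_all add: N_def)
  have int: "ennreal (\<integral>x. kernel_op K t (indicator A) x \<partial>M) = \<mu> A" if A: "A \<in> sets M" for A
  proof -
    have op: "kernel_op K t (indicator A) x = measure (K t x) A" if "x \<in> space M" for x
      using kernel_prob_space[of t x] t A that sets.sets_into_space[OF A]
      by (auto simp: kernel_op_def Int_absorb2)
    have le1: "measure (K t x) A \<le> 1" if "x \<in> space M" for x
      using kernel_prob_space[of t x] t that by (simp add: prob_space.prob_le_1)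
    have "integrable M (kernel_op K t (indicator A))"
      using A t le1 by (intro integrable_const_bound[of _ 1] kernel_op_measurable AE_I2) (auto simp: op)
    then have "ennreal (\<integral>x. kernel_op K t (indicator A) x \<partial>M) = (\<integral>\<^sup>+ x. ennreal (kernel_op K t (indicator A) x) \<partial>M)"
      by (intro nn_integral_eq_integral[symmetric] AE_I2) (auto simp: op)
    also have "\<dots> = \<mu> A" unfolding \<mu>_def
    proof (rule nn_integral_cong)
      fix x assume x: "x \<in> space M"
      interpret prob_space "K t x" using kernel_prob_space(1)[OF _ x] t by simp
      show "ennreal (kernel_op K t (indicator A) x) = emeasure (K t x) A"
        by (simp add: op[OF x] emeasure_eq_measure)
    qed
    finally show ?thesis .
  qed
  have "emeasure N (space N) \<noteq> \<infinity>"
    using N[OF sets.top] int[OF sets.top] by (metis ennreal_neq_top infinity_ennreal_def space_N)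
  then interpret N: finite_measure N by (rule finite_measureI)
  have "absolutely_continuous M N"
    unfolding absolutely_continuous_def
  proof
    fix A assume A: "A \<in> null_sets M"
    have "AE x in M. emeasure (K t x) A = 0"
      using kernel_AE[OF t AE_not_in[OF A]] AE_space
    proof eventually_elim
      case (elim x)
      show ?case using elim A kernel_prob_space[of t x] t sets.sets_into_space[of A M]
        by (subst (asm) AE_iff_measurable[of A]) (auto simp: null_sets_def)
    qed
    then have "\<mu> A = 0" using A by (simp add: \<mu>_def nn_integral_0_iff_AE meas null_sets_def)
    then show "A \<in> null_sets N" using A N[of A] by (simp add: null_sets_def sets_N)
  qed
  moreover have "(\<integral>x. kernel_op K t (indicator A) x \<partial>M) \<le> measure N A" if "A \<in> sets M" for A
    using int[OF that] N[OF that] by (metis N.emeasure_eq_measure ennreal_le_iff measure_nonneg order_refl)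
  ultimately show ?thesis
    using absolutely_continuous_epsilon_delta[OF finite_measure_axioms N.finite_measure_axioms _ sets_N e]
    by (meson le_less_trans)
qed

text \<open>Joint measurability is given for nonnegative functions only. So \<open>f\<close> is
  raised by its bound \<open>C\<close>, integrated over the space, and the constant C m(E) is
  subtracted afterwards.\<close>

lemma kernel_time_measurable:
  assumes f: "ess_bounded M f"
  shows "(\<lambda>s. indicator {0<..} s * (\<integral>x. kernel_op K s f x \<partial>M)) \<in> borel_measurable borel"
proof -
  obtain C where C: "0 \<le> C" "AE x in M. \<bar>f x\<bar> \<le> C" using f by (rule ess_boundedE)
  note [measurable] = ess_bounded_measurable[OF f]
  \<comment> \<open>\<open>ennreal\<close> truncates where f < -C, which happens on a null set
    only.\<close>
  define h where "h x = ennreal (f x + C)" for x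
  have h: "h \<in> borel_measurable M" unfolding h_def by measurable
  define J where "J s = (\<integral>\<^sup>+ x. \<integral>\<^sup>+ y. h y \<partial>K s x \<partial>M)" for s
  have "(\<lambda>(s, x). \<integral>\<^sup>+ y. h y \<partial>K s x) \<in> borel_measurable (restrict_space borel {0..} \<Otimes>\<^sub>M M)"
    using K h by (simp add: markov_transition_function_def)
  then have "J \<in> borel_measurable (restrict_space borel {0..})"
    unfolding J_def by (intro borel_measurable_nn_integral)
  then have [measurable]: "(\<lambda>s. J s * indicator {0..} s) \<in> borel_measurable borel"
    by (subst (asm) borel_measurable_restrict_space_iff_ennreal) auto
  have eq: "(\<integral>x. kernel_op K s f x \<partial>M) = enn2real (J s) - C * measure M (space M)" if s: "0 < s" for s
  proof -
    have AE_C: "AE x in M. 0 \<le> f x + C" using C(2) by eventually_elim auto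
    have pt: "AE x in M. (\<integral>\<^sup>+ y. h y \<partial>K s x) = ennreal (kernel_op K s f x + C) \<and> \<bar>kernel_op K s f x\<bar> \<le> C"
      using kernel_AE[OF s C(2)] kernel_AE[OF s AE_C] kernel_AE_integrable[OF s f] AE_space
    proof eventually_elim
      case (elim x)
      interpret prob_space "K s x" using kernel_prob_space(1)[OF _ elim(4)] s by simp
      have "(\<integral>\<^sup>+ y. h y \<partial>K s x) = ennreal (\<integral>y. f y + C \<partial>K s x)"
        unfolding h_def using elim by (intro nn_integral_eq_integral) auto
      moreover have "(\<integral>y. f y + C \<partial>K s x) = kernel_op K s f x + C"
        using elim(3) by (simp add: kernel_op_def prob_space)
      moreover have "\<bar>kernel_op K s f x\<bar> \<le> (\<integral>y. C \<partial>K s x)"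
        unfolding kernel_op_def using elim by (intro integral_abs_bound[THEN order_trans] integral_mono_AE) auto
      ultimately show ?case by (simp add: prob_space)
    qed
    have int: "integrable M (kernel_op K s f)"
      using pt s by (intro integrable_const_bound[of _ C] kernel_op_measurable) auto
    have "J s = (\<integral>\<^sup>+ x. ennreal (kernel_op K s f x + C) \<partial>M)"
      unfolding J_def using pt by (intro nn_integral_cong_AE) auto
    also have "\<dots> = ennreal (\<integral>x. kernel_op K s f x + C \<partial>M)"
      using int pt by (intro nn_integral_eq_integral) auto
    finally have "J s = ennreal ((\<integral>x. kernel_op K s f x \<partial>M) + C * measure M (space M))"
      using int by (simp add: mult.commute)
    moreover have "0 \<le> (\<integral>x. kernel_op K s f x + C \<partial>M)"
      using pt by (intro integral_nonneg_AE) auto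
    ultimately show ?thesis using int by (simp add: mult.commute)
  qed
  have "(\<lambda>s. indicator {0<..} s * (enn2real (J s * indicator {0..} s) - C * measure M (space M))) \<in> borel_measurable borel"
    by measurable
  also have "(\<lambda>s. indicator {0<..} s * (enn2real (J s * indicator {0..} s) - C * measure M (space M))) =
    (\<lambda>s. indicator {0<..} s * (\<integral>x. kernel_op K s f x \<partial>M))"
    using eq by (auto simp: fun_eq_iff indicator_def)
  finally show ?thesis .
qed

lemma kernel_ess_markov_semigroup: "ess_markov_semigroup M (kernel_op K)"
proof
  fix t s e :: real and f g :: "'a \<Rightarrow> real" and a b :: real
  show "kernel_op K t f \<in> borel_measurable M" if "0 < t" "ess_bounded M f"
    using that by (intro kernel_op_measurable) auto
  show "AE x in M. kernel_op K t (\<lambda>y. a * f y + b * g y) x = a * kernel_op K t f x + b * kernel_op K t g x"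
    if t: "0 < t" and fg: "ess_bounded M f" "ess_bounded M g"
    using kernel_AE_integrable[OF t fg(1)] kernel_AE_integrable[OF t fg(2)]
    by eventually_elim (simp add: kernel_op_def)
  show "AE x in M. 0 \<le> kernel_op K t f x" if "0 < t" "ess_bounded M f" "AE x in M. 0 \<le> f x"
    using kernel_AE[OF that(1,3)] by eventually_elim (simp add: kernel_op_def integral_nonneg_AE)
  show "AE x in M. kernel_op K t (\<lambda>_. 1) x = 1" if "0 < t"
    using kernel_prob_space(1)[of t] that by (intro AE_I2) (simp add: kernel_op_def prob_space.prob_space)
qed (use kernel_op_semigroup kernel_small kernel_time_measurable in blast)+

end

subsection \<open>Semigroups on Lebesgue spaces\<close>

context
  fixes M :: "'a measure" and p :: real and P :: "real \<Rightarrow> ('a \<Rightarrow> real) \<Rightarrow> 'a \<Rightarrow> real"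
  assumes fin: "finite_measure M" and P: "markov_Lp_semigroup M p P"
begin

interpretation finite_measure M by (rule fin)

lemma p_ge_1: "1 \<le> p"
  using P by (simp add: markov_Lp_semigroup_def)

lemma Lp_fun_measurable: "Lp_fun p M f \<Longrightarrow> f \<in> borel_measurable M"
  by (simp add: Lp_fun_def)

lemma ess_bounded_Lp_fun:
  assumes f: "ess_bounded M f" shows "Lp_fun p M f"
proof -
  obtain C where C: "0 \<le> C" "AE x in M. \<bar>f x\<bar> \<le> C" using f by (rule ess_boundedE)
  note [measurable] = ess_bounded_measurable[OF f]
  have "AE x in M. norm (\<bar>f x\<bar> powr p) \<le> C powr p"
    using C(2) by eventually_elim (use p_ge_1 in \<open>auto intro: powr_mono2\<close>)
  then have "integrable M (\<lambda>x. \<bar>f x\<bar> powr p)" by (rule integrable_const_bound) measurable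
  then show ?thesis by (simp add: Lp_fun_def)
qed

lemma Lp_fun_integrable:
  assumes "Lp_fun p M f" shows "integrable M f"
proof (rule Bochner_Integration.integrable_bound)
  show "integrable M (\<lambda>x. 1 + \<bar>f x\<bar> powr p)" using assms by (simp add: Lp_fun_def)
  show "f \<in> borel_measurable M" using assms by (rule Lp_fun_measurable)
  have "\<bar>y\<bar> \<le> 1 + \<bar>y\<bar> powr p" for y :: real
  proof (cases "1 \<le> \<bar>y\<bar>")
    case True
    then have "\<bar>y\<bar> powr 1 \<le> \<bar>y\<bar> powr p" using p_ge_1 by (intro powr_mono) auto
    then show ?thesis using True by simp
  qed (simp add: add_increasing2)
  then show "AE x in M. norm (f x) \<le> norm (1 + \<bar>f x\<bar> powr p)"
    by (auto intro: order_trans)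
qed

lemma Lp_closed: "0 \<le> t \<Longrightarrow> Lp_fun p M f \<Longrightarrow> Lp_fun p M (P t f)"
  using P by (simp add: markov_Lp_semigroup_def)

lemma Lp_lincomb: "0 \<le> t \<Longrightarrow> Lp_fun p M f \<Longrightarrow> Lp_fun p M g \<Longrightarrow>
    AE x in M. P t (\<lambda>y. a * f y + b * g y) x = a * P t f x + b * P t g x"
  using P by (simp add: markov_Lp_semigroup_def)

lemma Lp_nonneg: "0 \<le> t \<Longrightarrow> Lp_fun p M f \<Longrightarrow> AE x in M. 0 \<le> f x \<Longrightarrow> AE x in M. 0 \<le> P t f x"
  using P unfolding markov_Lp_semigroup_def by blast

lemma Lp_one: "0 \<le> t \<Longrightarrow> AE x in M. P t (\<lambda>_. 1) x = 1"
  using P unfolding markov_Lp_semigroup_def by blast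

lemma Lp_semigroup: "0 \<le> s \<Longrightarrow> 0 \<le> t \<Longrightarrow> Lp_fun p M f \<Longrightarrow> AE x in M. P (t + s) f x = P t (P s f) x"
  using P unfolding markov_Lp_semigroup_def by blast

lemma Lp_strongly_continuous: "Lp_fun p M f \<Longrightarrow>
    ((\<lambda>t. (\<integral>x. \<bar>P t f x - f x\<bar> powr p \<partial>M) powr (1 / p)) \<longlongrightarrow> 0) (at_right 0)"
  using P unfolding markov_Lp_semigroup_def by blast

text \<open>Positivity is applied to C + f and C - f, and P_t 1 = 1 turns the results into the two
  bounds.\<close>

lemma Lp_ess_bound:
  assumes t: "0 \<le> t" and f: "ess_bounded M f" "AE x in M. \<bar>f x\<bar> \<le> C"
  shows "AE x in M. \<bar>P t f x\<bar> \<le> C"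
proof -
  note Lf = ess_bounded_Lp_fun[OF f(1)] and L1 = ess_bounded_Lp_fun[OF ess_bounded_const[of M 1]]
  have nn: "AE x in M. 0 \<le> P t (\<lambda>y. C * 1 + a * f y) x" if "\<bar>a\<bar> = 1" for a
  proof (rule Lp_nonneg[OF t])
    show "Lp_fun p M (\<lambda>y. C * 1 + a * f y)"
      by (intro ess_bounded_Lp_fun ess_bounded_add ess_bounded_cmult f ess_bounded_const)
    show "AE x in M. 0 \<le> C * 1 + a * f x"
      using f(2) by eventually_elim (use that in \<open>auto simp: abs_if split: if_splits\<close>)
  qed
  show ?thesis
    using nn[OF abs_one] nn[OF abs_neg_one] Lp_lincomb[OF t L1 Lf, of C 1] Lp_lincomb[OF t L1 Lf, of C "-1"] Lp_one[OF t]
    by eventually_elim auto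
qed

lemma Lp_ess_bounded: "0 \<le> t \<Longrightarrow> ess_bounded M f \<Longrightarrow> ess_bounded M (P t f)"
  by (meson Lp_ess_bound Lp_closed Lp_fun_measurable ess_bounded_Lp_fun ess_boundedE ess_boundedI)

lemma Lp_pos_functional:
  assumes t: "0 \<le> t" shows "pos_functional M (\<lambda>f. \<integral>x. P t f x \<partial>M)"
  unfolding pos_functional_def
proof (intro conjI allI impI)
  fix f g a b assume fg: "ess_bounded M f" "ess_bounded M g"
  have "(\<integral>x. P t (\<lambda>x. a * f x + b * g x) x \<partial>M) = (\<integral>x. a * P t f x + b * P t g x \<partial>M)"
    using t fg Lp_fun_measurable[OF Lp_closed[OF t ess_bounded_Lp_fun]]
    by (intro integral_cong_AE Lp_lincomb ess_bounded_Lp_fun)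
      (auto intro!: ess_bounded_lincomb Lp_ess_bounded intro: ess_bounded_measurable)
  also have "\<dots> = a * (\<integral>x. P t f x \<partial>M) + b * (\<integral>x. P t g x \<partial>M)"
    using Lp_fun_integrable[OF Lp_closed[OF t ess_bounded_Lp_fun]] fg by simp
  finally show "(\<integral>x. P t (\<lambda>x. a * f x + b * g x) x \<partial>M) = a * (\<integral>x. P t f x \<partial>M) + b * (\<integral>x. P t g x \<partial>M)" .
qed (use t Lp_nonneg ess_bounded_Lp_fun integral_nonneg_AE in blast)

text \<open>Positive operators on a Banach lattice are automatically bounded: if the conclusion failed along
  sets \<open>A k\<close> of rapidly decreasing measure, some \<open>F\<close> in \<open>L\<^sup>p\<close> would dominate every
  \<open>(k + 1) * indicator (A k)\<close>.\<close>

lemma Lp_small: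
  assumes t: "0 \<le> t" and e: "0 < e"
  shows "\<exists>\<eta>>0. \<forall>A\<in>sets M. measure M A < \<eta> \<longrightarrow> (\<integral>x. P t (indicator A) x \<partial>M) < e"
proof (rule ccontr)
  assume *: "\<not> ?thesis"
  \<comment> \<open>The weights are p-th powers so that their p-th roots are the factors k + 1;
    dividing the measures by them keeps the weighted sum \<open>S\<close> integrable.\<close>
  define w where "w k = real (Suc k) powr p" for k
  have w: "0 < w k" for k by (simp add: w_def)
  have "\<exists>A\<in>sets M. measure M A < (1/2)^k / w k \<and> e \<le> (\<integral>x. P t (indicator A) x \<partial>M)" for k
  proof -
    have "0 < (1/2)^k / w k" using w by simp
    with * show ?thesis by (meson not_less)
  qed
  then obtain A where A: "\<And>k. A k \<in> sets M" "\<And>k. measure M (A k) < (1/2)^k / w k"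
    "\<And>k. e \<le> (\<integral>x. P t (indicator (A k)) x \<partial>M)" by metis
  note [measurable] = A(1)
  define S where "S x = (\<Sum>k. ennreal (w k) * indicator (A k) x)" for x
  have [measurable]: "S \<in> borel_measurable M" unfolding S_def by measurable
  have "(\<integral>\<^sup>+ x. S x \<partial>M) = (\<Sum>k. ennreal (w k) * emeasure M (A k))"
    unfolding S_def by (subst nn_integral_suminf) (auto simp: nn_integral_cmult_indicator)
  also have "\<dots> \<le> (\<Sum>k. ennreal ((1/2)^k))"
  proof (intro suminf_le allI)
    fix k
    have "w k * measure M (A k) \<le> (1/2)^k"
      using A(2)[of k] w[of k] by (simp add: pos_less_divide_eq mult.commute)
    then show "ennreal (w k) * emeasure M (A k) \<le> ennreal ((1/2)^k)"
      using w[of k] by (simp add: emeasure_eq_measure ennreal_mult[symmetric] ennreal_leI)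
  qed auto
  also have "\<dots> = ennreal (\<Sum>k. (1/2)^k)" by (rule suminf_ennreal2) auto
  finally have S_fin: "(\<integral>\<^sup>+ x. S x \<partial>M) < \<infinity>" by (auto simp: top_unique less_top[symmetric])
  then have S_AE: "AE x in M. S x \<noteq> \<infinity>" by (intro nn_integral_PInf_AE) auto
  \<comment> \<open>The p-th power of \<open>F\<close> is \<open>S\<close>, so \<open>F\<close> is
    in L^p; infinite values of \<open>S\<close>, on a null set, become 0.\<close>
  define F where "F x = enn2real (S x) powr (1 / p)" for x
  have F: "Lp_fun p M F"
  proof -
    have "\<bar>F x\<bar> powr p = enn2real (S x)" for x
      using p_ge_1 by (simp add: F_def powr_powr)
    moreover have "integrable M (\<lambda>x. enn2real (S x))"
    proof (rule integrableI_nonneg)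
      have "(\<integral>\<^sup>+ x. ennreal (enn2real (S x)) \<partial>M) \<le> (\<integral>\<^sup>+ x. S x \<partial>M)"
        by (intro nn_integral_mono) (simp add: ennreal_enn2real_if)
      also note S_fin
      finally show "(\<integral>\<^sup>+ x. ennreal (enn2real (S x)) \<partial>M) < \<infinity>" .
    qed auto
    ultimately show ?thesis unfolding Lp_fun_def by (simp add: F_def[abs_def])
  qed
  have term_le: "u k \<le> (\<Sum>j. u j)" for u :: "nat \<Rightarrow> ennreal" and k
    using sum_le_suminf[OF summableI, of "{k}" u] by simp
  have bound: "real (Suc k) * e \<le> (\<integral>x. P t F x \<partial>M)" for k
  proof -
    have dom: "AE x in M. 0 \<le> 1 * F x + (- real (Suc k)) * indicator (A k) x"
      using S_AE
    proof eventually_elim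
      case (elim x)
      show ?case
      proof (cases "x \<in> A k")
        case True
        have "ennreal (w k) * indicator (A k) x \<le> S x"
          unfolding S_def by (rule term_le)
        then have "w k \<le> enn2real (S x)"
          using True w[of k] elim by (cases "S x") (auto simp: less_imp_le)
        then have "w k powr (1 / p) \<le> F x"
          unfolding F_def using w[of k] p_ge_1 by (intro powr_mono2) auto
        moreover have "w k powr (1 / p) = real (Suc k)" using p_ge_1 by (simp add: w_def powr_powr)
        ultimately show ?thesis using True by simp
      qed (simp add: F_def)
    qed
    have LA: "Lp_fun p M (indicator (A k))" by (intro ess_bounded_Lp_fun ess_bounded_indicator A)
    \<comment> \<open>Almost everywhere the difference lies between 0 and \<open>F\<close>, hence is
      in L^p too, and positivity of \<open>P t\<close> may be applied to it.\<close>
    have LD: "Lp_fun p M (\<lambda>x. 1 * F x + (- real (Suc k)) * indicator (A k) x)"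
    proof -
      have "(\<lambda>x. 1 * F x + (- real (Suc k)) * indicator (A k) x) \<in> borel_measurable M"
        using Lp_fun_measurable[OF F] by measurable
      moreover have "AE x in M. norm (\<bar>1 * F x + (- real (Suc k)) * indicator (A k) x\<bar> powr p) \<le> norm (\<bar>F x\<bar> powr p)"
        using dom
      proof eventually_elim
        case (elim x)
        then have "\<bar>1 * F x + (- real (Suc k)) * indicator (A k) x\<bar> \<le> \<bar>F x\<bar>" by (auto simp: indicator_def split: if_splits)
        then show ?case using p_ge_1 by (auto intro: powr_mono2)
      qed
      ultimately show ?thesis using F unfolding Lp_fun_def
        by (auto intro: Bochner_Integration.integrable_bound simp del: norm_powr_real)
    qed
    have "AE x in M. real (Suc k) * P t (indicator (A k)) x \<le> P t F x"
      using Lp_nonneg[OF t LD dom] Lp_lincomb[OF t F LA, of 1 "- real (Suc k)"]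
      by eventually_elim (auto simp: ring_distribs)
    then have "(\<integral>x. real (Suc k) * P t (indicator (A k)) x \<partial>M) \<le> (\<integral>x. P t F x \<partial>M)"
      using Lp_fun_integrable[OF Lp_closed[OF t LA]] Lp_fun_integrable[OF Lp_closed[OF t F]]
      by (intro integral_mono_AE) auto
    moreover have "real (Suc k) * e \<le> real (Suc k) * (\<integral>x. P t (indicator (A k)) x \<partial>M)"
      by (intro mult_left_mono A) auto
    ultimately show ?thesis unfolding integral_mult_right_zero by (rule order_trans[rotated])
  qed
  obtain k where "(\<integral>x. P t F x \<partial>M) / e < real k" using reals_Archimedean2 by blast
  then have "(\<integral>x. P t F x \<partial>M) < real (Suc k) * e" using e by (simp add: pos_divide_less_eq algebra_simps)
  with bound[of k] show False by simp
qed

text \<open>By the semigroup law the increment is P_x (P_h f - f). The function g = P_h f - f is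
  small in L^p, hence small off a set \<open>B\<close> of small measure; on \<open>B\<close> it is
  at most 2 C, and \<open>Lp_small\<close> controls P_x 1_B.\<close>

lemma Lp_right_continuous:
  assumes x: "0 \<le> x" and f: "ess_bounded M f"
  shows "((\<lambda>s. \<integral>y. P s f y \<partial>M) \<longlongrightarrow> (\<integral>y. P x f y \<partial>M)) (at_right x)"
proof -
  let ?L = "\<lambda>f. \<integral>y. P x f y \<partial>M"
  note L = Lp_pos_functional[OF x]
  obtain C where C: "0 \<le> C" "AE y in M. \<bar>f y\<bar> \<le> C" using f by (rule ess_boundedE)
  have "((\<lambda>h. \<integral>y. P (h + x) f y \<partial>M) \<longlongrightarrow> ?L f) (at_right 0)"
  proof (rule tendstoI)
    fix e :: real assume e: "0 < e"
    \<comment> \<open>\<open>a\<close> bounds the contribution from outside \<open>B\<close>, and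
      \<open>d\<close> below the one from \<open>B\<close>, by e/2 each; the added 1's keep the
      denominators positive.\<close>
    define a where "a = e / (2 * (?L (\<lambda>_. 1) + 1))"
    have den: "0 < ?L (\<lambda>_. 1) + 1" using pos_functional_one_nonneg[OF L] by simp
    have a: "0 < a" using e den by (simp add: a_def)
    have aL: "a * ?L (\<lambda>_. 1) < e / 2"
    proof -
      have "a * ?L (\<lambda>_. 1) < a * (?L (\<lambda>_. 1) + 1)" using a by simp
      also have "\<dots> = e / 2" using den by (simp add: a_def field_simps)
      finally show ?thesis .
    qed
    define d where "d = e / (2 * (2 * C + 1))"
    have d: "0 < d" using e C(1) by (simp add: d_def)
    have dC: "2 * C * d \<le> e / 2"
    proof -
      have "2 * C * d \<le> (2 * C + 1) * d" using d by simp
      also have "\<dots> = e / 2" using C(1) by (simp add: d_def field_simps)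
      finally show ?thesis .
    qed
    obtain \<eta> where \<eta>: "0 < \<eta>" "\<And>B. B \<in> sets M \<Longrightarrow> measure M B < \<eta> \<Longrightarrow> ?L (indicator B) < d"
      using Lp_small[OF x d] by blast
    \<comment> \<open>By Markov's inequality for the p-th power, an L^p norm below this threshold
      gives the set where |g| is at least \<open>a\<close> measure below \<eta>.\<close>
    have "0 < (a powr p * \<eta>) powr (1 / p)" using a \<eta>(1) by simp
    with Lp_strongly_continuous[OF ess_bounded_Lp_fun[OF f]]
    have "eventually (\<lambda>h. (\<integral>y. \<bar>P h f y - f y\<bar> powr p \<partial>M) powr (1 / p) < (a powr p * \<eta>) powr (1 / p)) (at_right 0)"
      by (rule order_tendstoD)
    then show "eventually (\<lambda>h. dist (\<integral>y. P (h + x) f y \<partial>M) (?L f) < e) (at_right 0)"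
      using eventually_at_right_less[of 0]
    proof eventually_elim
      case (elim h)
      define g where "g y = P h f y - f y" for y
      have h: "0 \<le> h" using elim(2) by simp
      have Ph: "ess_bounded M (P h f)" by (rule Lp_ess_bounded[OF h f])
      have g: "ess_bounded M g" unfolding g_def by (intro ess_bounded_diff Ph f)
      note [measurable] = ess_bounded_measurable[OF g]
      have g_bound: "AE y in M. \<bar>g y\<bar> \<le> 2 * C"
        using Lp_ess_bound[OF h f C(2)] C(2) by eventually_elim (auto simp: g_def)
      define B where "B = {y \<in> space M. a \<le> \<bar>g y\<bar>}"
      have B: "B \<in> sets M" unfolding B_def by measurable
      have gp: "integrable M (\<lambda>y. \<bar>g y\<bar> powr p)" using ess_bounded_Lp_fun[OF g] by (simp add: Lp_fun_def)
      have "(\<integral>y. \<bar>g y\<bar> powr p \<partial>M) < a powr p * \<eta>"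
      proof (rule ccontr)
        assume "\<not> ?thesis"
        then have "(a powr p * \<eta>) powr (1 / p) \<le> (\<integral>y. \<bar>g y\<bar> powr p \<partial>M) powr (1 / p)"
          using a \<eta>(1) p_ge_1 by (intro powr_mono2) auto
        with elim(1) show False by (simp add: g_def)
      qed
      moreover have "(\<integral>y. a powr p * indicator B y \<partial>M) \<le> (\<integral>y. \<bar>g y\<bar> powr p \<partial>M)"
        using a p_ge_1
        by (intro integral_mono gp ess_bounded_integrable ess_bounded_cmult ess_bounded_indicator B)
          (auto simp: B_def indicator_def intro: powr_mono2)
      ultimately have "a powr p * measure M B < a powr p * \<eta>" using B by simp
      then have "measure M B < \<eta>" using a by simp
      then have LB: "?L (indicator B) < d" by (rule \<eta>(2)[OF B])
      have eb: "ess_bounded M (\<lambda>y. a * 1 + 2 * C * indicator B y)"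
        by (intro ess_bounded_lincomb[where f = "\<lambda>_. 1"] ess_bounded_const ess_bounded_indicator B)
      have dom: "AE y in M. \<bar>g y\<bar> \<le> a * 1 + 2 * C * indicator B y"
        using g_bound AE_space by eventually_elim (use a in \<open>auto simp: B_def indicator_def\<close>)
      have Leb: "?L (\<lambda>y. a * 1 + 2 * C * indicator B y) = a * ?L (\<lambda>_. 1) + 2 * C * ?L (indicator B)"
        by (rule pos_functional_lincomb[OF L ess_bounded_const ess_bounded_indicator[OF B]])
      have "?L g \<le> ?L (\<lambda>y. a * 1 + 2 * C * indicator B y)"
        using dom by (intro pos_functional_mono[OF L] g eb) auto
      moreover have "?L (\<lambda>y. (- 1) * (a * 1 + 2 * C * indicator B y)) \<le> ?L g"
        using dom by (intro pos_functional_mono[OF L] g ess_bounded_cmult eb) auto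
      then have "- ?L (\<lambda>y. a * 1 + 2 * C * indicator B y) \<le> ?L g"
        unfolding pos_functional_cmult[OF L eb] by simp
      ultimately have "\<bar>?L g\<bar> \<le> a * ?L (\<lambda>_. 1) + 2 * C * ?L (indicator B)"
        unfolding Leb by (simp add: abs_le_iff)
      also have "2 * C * ?L (indicator B) \<le> 2 * C * d" using LB C(1) by (intro mult_left_mono) auto
      finally have "\<bar>?L g\<bar> < e" using aL dC by simp
      moreover have "?L g = ?L (P h f) - ?L f"
        unfolding g_def by (rule pos_functional_diff[OF L Ph f])
      moreover have "(\<integral>y. P (h + x) f y \<partial>M) = ?L (P h f)"
        using Lp_semigroup[OF h x ess_bounded_Lp_fun[OF f]] h x
        by (intro integral_cong_AE ess_bounded_measurable Lp_ess_bounded f Ph) (auto simp: add.commute)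
      ultimately show ?case by (simp add: dist_real_def)
    qed
  qed
  then show ?thesis by (simp add: filterlim_at_right_to_0[of _ _ x])
qed

lemma Lp_time_measurable:
  assumes f: "ess_bounded M f"
  shows "(\<lambda>s. indicator {0<..} s * (\<integral>x. P s f x \<partial>M)) \<in> borel_measurable borel"
proof -
  \<comment> \<open>The value 0 at negative times makes \<open>r\<close> right continuous on the
    whole line: the possible jump at 0 is seen from the left only.\<close>
  define r where "r s = (if s < 0 then 0 else \<integral>y. P s f y \<partial>M)" for s
  have "(r \<longlongrightarrow> r x) (at_right x)" for x
  proof (cases "x < 0")
    case True
    have "eventually (\<lambda>s. s \<in> {x<..<0}) (at_right x)" using True by (rule eventually_at_right_real)
    then have "eventually (\<lambda>s. r s = r x) (at_right x)" by eventually_elim (use True in \<open>auto simp: r_def\<close>)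
    then show ?thesis by (rule tendsto_eventually)
  next
    case False
    have "eventually (\<lambda>s. (\<integral>y. P s f y \<partial>M) = r s) (at_right x)"
      using eventually_at_right_less[of x] by eventually_elim (use False in \<open>auto simp: r_def\<close>)
    then show ?thesis
      using Lp_right_continuous[of x f] False f by (auto simp: r_def elim: Lim_transform_eventually)
  qed
  then have [measurable]: "r \<in> borel_measurable borel" by (rule right_continuous_borel_measurable)
  have "(\<lambda>s. indicator {0<..} s * (\<integral>x. P s f x \<partial>M)) = (\<lambda>s. indicator {0<..} s * r s)"
    by (auto simp: fun_eq_iff r_def indicator_def)
  then show ?thesis by simp
qed

lemma Lp_ess_markov_semigroup: "ess_markov_semigroup M P"
proof
  fix t s :: real and f g :: "'a \<Rightarrow> real"
  show "AE x in M. P (t + s) f x = P t (P s f) x" if "0 < s" "0 < t" "ess_bounded M f"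
    using that by (intro Lp_semigroup ess_bounded_Lp_fun) auto
  show "P t f \<in> borel_measurable M" if "0 < t" "ess_bounded M f"
    using that by (intro ess_bounded_measurable Lp_ess_bounded) auto
  show "AE x in M. 0 \<le> P t f x" if "0 < t" "ess_bounded M f" "AE x in M. 0 \<le> f x"
    using that by (intro Lp_nonneg ess_bounded_Lp_fun) auto
qed (auto intro!: Lp_small Lp_time_measurable Lp_lincomb Lp_one ess_bounded_Lp_fun)

end

theorem theorem2p4:
  fixes M :: "'a measure" and P :: "real \<Rightarrow> ('a \<Rightarrow> real) \<Rightarrow> 'a \<Rightarrow> real"
  assumes "finite_measure M" and "emeasure M (space M) \<noteq> 0"
    and "(\<exists>p. markov_Lp_semigroup M p P) \<or>
         (\<exists>K. markov_transition_function M K \<and> P = kernel_op K)"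
  shows "((\<exists>\<nu>. invariant_measure M P \<nu> \<and> absolutely_continuous M \<nu>) \<longleftrightarrow> almost_invariant M P)
    \<and> (almost_invariant M P \<longleftrightarrow>
         (\<forall>tn. incr_to_infinity tn \<longrightarrow> mean_almost_invariant M P tn))
    \<and> ((\<forall>tn. incr_to_infinity tn \<longrightarrow> mean_almost_invariant M P tn) \<longleftrightarrow>
         (\<forall>tn. incr_to_infinity tn \<longrightarrow> cconst M P tn < ereal (measure M (space M))))
    \<and> ((\<forall>tn. incr_to_infinity tn \<longrightarrow> cconst M P tn < ereal (measure M (space M))) \<longleftrightarrow>
         (\<exists>tn. incr_to_infinity tn \<and> cconst M P tn < ereal (measure M (space M))))"
proof -
  interpret ess_markov_semigroup M P
    using assms(1,3) Lp_ess_markov_semigroup kernel_ess_markov_semigroup by blast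
  show ?thesis by (rule invariant_measure_equivalences[OF assms(2)])
qed

end
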